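(* Let $0<q<1$, $\delta=\frac{2\pi i}{\log q}$, let $0<z\le1$, and let $s\in\mathbb{C}$ with $\Re s<0$ and $s\ne -r+\delta l$ for all positive integers $r$ and nonzero integers $l$. Define $$\zeta^*(s,z:q)=\zeta(s,z:q)+\frac{(q-q^2)^s q^{-zs}}{\log q}\,\frac{\pi}{\sin\pi s}.$$ Then $$\zeta^*(s,z:q)=-\frac{1}{2\pi i}(q-q^2)^s q^{-zs}\,\Gamma(1-s)\sum_{l\ne0}\frac1l\,\frac{\Gamma(s+\delta l)}{\Gamma(\delta l)}e^{-2\pi i l z},$$ where $l$ runs over the nonzero integers.
   Context: $[x]_q=\frac{1-q^x}{1-q}$, and $\zeta(s,z:q)$ denotes the meromorphic continuation to the whole $s$-plane of $\sum_{k=0}^{\infty}q^{s(k+1)}/[k+z]_q^{\,s}$ (convergent for $\Re s>0$), with complex powers via the principal branch; $\Gamma$ is Euler's gamma function. *)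

theory Defs
  imports "HOL-Complex_Analysis.Complex_Analysis"
begin

definition qnum :: "real \<Rightarrow> real \<Rightarrow> real" where
  "qnum q x = (1 - q powr x) / (1 - q)"

text \<open>The defining series of zeta(s,z:q), convergent for Re s > 0; complex powers of
  positive reals via the principal branch (Isabelle's complex powr).\<close>
definition zeta_q_series :: "real \<Rightarrow> real \<Rightarrow> complex \<Rightarrow> complex" where
  "zeta_q_series q z s =
     (\<Sum>k. (complex_of_real q) powr (s * of_nat (k + 1))
            / (complex_of_real (qnum q (real k + z))) powr s)"

text \<open>zeta(s,z:q): the meromorphic continuation to the whole plane of the series.
  We take the (unique) nicely meromorphic function on UNIV (removable singularities
  filled in) that agrees with the series on Re s > 0.\<close>
definition zeta_q :: "real \<Rightarrow> real \<Rightarrow> complex \<Rightarrow> complex" where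
  "zeta_q q z = (SOME f. f nicely_meromorphic_on UNIV \<and>
                    (\<forall>s. 0 < Re s \<longrightarrow> f s = zeta_q_series q z s))"

text \<open>zeta^*(s,z:q), as a meromorphic function: removable singularities (e.g. at
  s = -r, where the pole of zeta cancels against that of pi/sin(pi s)) are filled in
  by their limits via remove_sings; elsewhere it is the literal defining expression.\<close>
definition zeta_q_star :: "real \<Rightarrow> real \<Rightarrow> complex \<Rightarrow> complex" where
  "zeta_q_star q z = remove_sings (\<lambda>s. zeta_q q z s
     + (complex_of_real (q - q\<^sup>2)) powr s * (complex_of_real q) powr (- (of_real z * s))
       / of_real (ln q) * (of_real pi / sin (of_real pi * s)))"

end

theory Submission
  imports Defs
begin

text \<open>
  Write \<open>c = ln q\<close>, \<open>\<delta> = 2\<pi>\<i>/c\<close> and let \<open>a\<^sub>n(s) = (s)\<^sub>n / n!\<close>. Expanding \<open>(1 - q\<^bsup>k + z\<^esup>)\<^bsup>-s\<^esup>\<close> by the binomial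
  series and summing over \<open>k\<close> continues \<open>\<zeta>\<close> to the plane as the prefactor \<open>(q - q\<^sup>2)\<^sup>s q\<^bsup>-zs\<^esup>\<close> times
  \<open>\<Sum>\<^sub>n a\<^sub>n(s) G(s + n)\<close> with \<open>G(u) = q\<^bsup>uz\<^esup> / (1 - q\<^sup>u)\<close>.
  For \<open>Re s < 0\<close> one has \<open>\<Sum>\<^sub>n a\<^sub>n(s) / (s + n + \<delta>l) = \<Gamma>(1 - s) \<Gamma>(s + \<delta>l) / \<Gamma>(1 + \<delta>l)\<close>; the case \<open>l = 0\<close> is
  \<open>\<pi> / sin \<pi>s\<close>, so \<open>\<zeta>\<^sup>*\<close> arises by replacing \<open>G(u)\<close> with \<open>K(u) = G(u) + 1/(cu)\<close>, which is regular at 0.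
  The Fourier expansion of \<open>K\<close> in \<open>z\<close> has the terms \<open>- e\<^bsup>-2\<pi>\<i>lz\<^esup> / (c (u + \<delta>l))\<close>, \<open>l \<noteq> 0\<close>, and exchanging
  the sums gives the claim. As this expansion converges only conditionally, the sum over \<open>n\<close> is first
  summed by parts, which replaces \<open>K(u)\<close> by \<open>K(u) - K(u + 1)\<close> and makes the double series absolutely
  convergent.
\<close>

section \<open>Binomial coefficients and the Beta series\<close>

text \<open>The double series cannot be rearranged as it stands, because 1/(s + n + \<delta>l) is
  only of order 1/l. One Abel summation helps in two ways. First, the terms become multiples of
  a_n(s + 1) / ((u + \<delta>l)(u + 1 + \<delta>l)) with u = s + n, where a_n(s + 1) is at most of
  order n^(Re s); since Re s < 0, this leaves just enough room to share the quadratic decay between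
  n and l. Second, z = 1 comes within reach: the values of K at z = 0 and z = 1 differ by 1 whatever
  u is, so the Fourier series of K alone does not represent it there, but the jump cancels in K(u) -
  K(u + 1), whose series converges uniformly in z. Negative integers s are not excluded, and there
  the poles of \<zeta> and pi / sin(pi s) have to be cancelled by a limit. The identity with K is
  therefore proved on a punctured neighbourhood and carried to s by continuity. The excluded points
  -r + \<delta>l are those where some u + \<delta>l with l \<noteq> 0 vanishes.\<close>

definition binom_coeff :: "complex \<Rightarrow> nat \<Rightarrow> complex" where
  "binom_coeff s n = pochhammer s n / fact n"

lemma binom_coeff_0 [simp]: "binom_coeff s 0 = 1"
  by (simp add: binom_coeff_def)

lemma binom_coeff_Suc: "binom_coeff s (Suc n) = (s + of_nat n) / of_nat (Suc n) * binom_coeff s n"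
  by (simp add: binom_coeff_def pochhammer_Suc field_simps)

lemma binom_coeff_Suc': "binom_coeff s (Suc n) = s / of_nat (Suc n) * binom_coeff (s + 1) n"
  by (simp add: binom_coeff_def pochhammer_rec field_simps)

text \<open>Pascal's rule. It makes the a_n(s + 1) the partial sums of the a_n(s), which is what the
  summation by parts rests on.\<close>

lemma binom_coeff_plus1_Suc:
  "binom_coeff (s + 1) (Suc n) = binom_coeff (s + 1) n + binom_coeff s (Suc n)"
proof -
  have "of_nat (Suc n) \<noteq> (0::complex)" by (metis nat.distinct(2) of_nat_eq_0_iff)
  thus ?thesis unfolding binom_coeff_Suc' [of s] binom_coeff_Suc [of "s + 1"]
    by (simp add: field_simps)
qed

section \<open>Growth of the binomial coefficients and summation by parts\<close>

text \<open>Unlike exp (norm w), this bound keeps the sign of Re w, from which the decay for Re s <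
  0 comes. With w = s/k the quadratic error is summable over k.\<close>

lemma norm_one_plus_le_exp: "norm (1 + w) \<le> exp (Re w + (norm w)\<^sup>2 / 2)" for w :: complex
proof -
  have "(norm (1 + w))\<^sup>2 = 1 + (2 * Re w + (norm w)\<^sup>2)"
    unfolding cmod_power2 by (simp add: power2_eq_square algebra_simps)
  also have "\<dots> \<le> exp (2 * Re w + (norm w)\<^sup>2)" by (rule exp_ge_add_one_self)
  also have "\<dots> = (exp (Re w + (norm w)\<^sup>2 / 2))\<^sup>2"
    by (simp add: power2_eq_square flip: exp_add)
  finally show ?thesis by (rule power2_le_imp_le) simp
qed

text \<open>Gives the quadratic errors a telescoping budget: the bound 1 - 1/(n + 1) on their sum
  can be carried through an induction, which a bare constant cannot.\<close>

lemma inverse_square_telescope_le: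
  "1 / (2 * (real (Suc n))\<^sup>2) \<le> 1 / real (Suc n) - 1 / real (Suc (Suc n))"
proof -
  have "1 / (2 * (real (Suc n))\<^sup>2) \<le> 1 / (real (Suc n) * real (Suc (Suc n)))"
  proof (intro divide_left_mono)
    show "real (Suc n) * real (Suc (Suc n)) \<le> 2 * (real (Suc n))\<^sup>2"
      unfolding power2_eq_square mult.left_commute [of 2] by (intro mult_left_mono) auto
  qed auto
  also have "\<dots> = 1 / real (Suc n) - 1 / real (Suc (Suc n))"
    by (simp add: divide_simps)
  finally show ?thesis .
qed

text \<open>Here a_n(s + 1) is the product of 1 + s/k for k = 1, ..., n. The real parts of s/k add
  up to Re s times a harmonic number, which is at least ln (n + 1); as Re s \<le> 0, this yields the
  power. The constant depends on norm s alone, so the bound can be made uniform near a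
  point.\<close>

lemma norm_binom_coeff_plus1_le:
  assumes "Re s \<le> 0"
  shows "norm (binom_coeff (s + 1) n) \<le> exp ((norm s)\<^sup>2) * real (Suc n) powr Re s"
proof -
  have "norm (binom_coeff (s + 1) n) \<le>
          exp (Re s * harm n + (norm s)\<^sup>2 * (1 - 1 / real (Suc n)))"
  proof (induction n)
    case (Suc n)
    define w where "w = s / of_nat (Suc n)"
    have ne: "of_nat (Suc n) \<noteq> (0::complex)" by (metis nat.distinct(2) of_nat_eq_0_iff)
    have "binom_coeff (s + 1) (Suc n) = (1 + w) * binom_coeff (s + 1) n"
      using ne by (simp add: binom_coeff_Suc w_def field_simps)
    hence "norm (binom_coeff (s + 1) (Suc n)) = norm (1 + w) * norm (binom_coeff (s + 1) n)"
      by (simp add: norm_mult)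
    also have "\<dots> \<le> exp (Re w + (norm w)\<^sup>2 / 2) *
                     exp (Re s * harm n + (norm s)\<^sup>2 * (1 - 1 / real (Suc n)))"
      by (intro mult_mono norm_one_plus_le_exp Suc.IH) auto
    also have "\<dots> = exp (Re s * harm (Suc n) + (norm s)\<^sup>2 *
                     (1 - 1 / real (Suc n) + 1 / (2 * (real (Suc n))\<^sup>2)))"
    proof -
      have 1: "Re w = Re s / real (Suc n)" unfolding w_def by (rule Re_divide_of_nat)
      have 2: "norm w = norm s / real (Suc n)" unfolding w_def norm_divide norm_of_nat ..
      show ?thesis
        unfolding exp_add [symmetric] 1 2 harm_Suc by (simp add: power_divide field_simps del: of_nat_Suc)
    qed
    also have "\<dots> \<le> exp (Re s * harm (Suc n) + (norm s)\<^sup>2 * (1 - 1 / real (Suc (Suc n))))"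
    proof -
      have "1 / (2 * (real (Suc n))\<^sup>2) \<le> 1 / real (Suc n) - 1 / real (Suc (Suc n))"
        by (rule inverse_square_telescope_le)
      thus ?thesis
        by (simp add: mult_left_mono)
    qed
    finally show ?case .
  qed (simp add: harm_def)
  also have "\<dots> \<le> exp (Re s * ln (real (Suc n)) + (norm s)\<^sup>2 * 1)"
  proof -
    have "ln (real (Suc n)) \<le> harm n" using ln_le_harm [of n] by (simp add: add_ac)
    hence "Re s * harm n \<le> Re s * ln (real (Suc n))"
      using assms by (rule mult_left_mono_neg)
    moreover have "(norm s)\<^sup>2 * (1 - 1 / real (Suc n)) \<le> (norm s)\<^sup>2 * 1"
      by (intro mult_left_mono) auto
    ultimately show ?thesis unfolding exp_le_cancel_iff by (rule add_mono)
  qed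
  also have "\<dots> = exp ((norm s)\<^sup>2) * real (Suc n) powr Re s"
    by (simp add: powr_def exp_add mult_ac)
  finally show ?thesis .
qed

lemma norm_binom_coeff_Suc_le:
  assumes "Re s \<le> 0"
  shows "norm (binom_coeff s (Suc n)) \<le> norm s * exp ((norm s)\<^sup>2) * real (Suc n) powr (Re s - 1)"
proof -
  have "norm (binom_coeff s (Suc n)) = norm s / real (Suc n) * norm (binom_coeff (s + 1) n)"
    unfolding binom_coeff_Suc' norm_mult norm_divide norm_of_nat ..
  also have "\<dots> \<le> norm s / real (Suc n) * (exp ((norm s)\<^sup>2) * real (Suc n) powr Re s)"
    by (intro mult_left_mono norm_binom_coeff_plus1_le assms) auto
  also have "\<dots> = norm s * exp ((norm s)\<^sup>2) * real (Suc n) powr (Re s - 1)"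
    by (simp add: powr_diff)
  finally show ?thesis .
qed

lemma summable_powr_Suc: "p < -1 \<Longrightarrow> summable (\<lambda>n. real (Suc n) powr p)"
  using summable_Suc_iff [of "\<lambda>n. real n powr p"] by (simp add: summable_real_powr_iff)

lemma summable_norm_binom_coeff:
  assumes "Re s < 0"
  shows "summable (\<lambda>n. norm (binom_coeff s n))"
proof -
  have "summable (\<lambda>n. norm s * exp ((norm s)\<^sup>2) * real (Suc n) powr (Re s - 1))"
    by (intro summable_mult summable_powr_Suc) (use assms in auto)
  hence "summable (\<lambda>n. norm (binom_coeff s (Suc n)))"
    by (rule summable_comparison_test') (use norm_binom_coeff_Suc_le [of s] assms in auto)
  thus ?thesis using summable_Suc_iff [of "\<lambda>n. norm (binom_coeff s n)"] by simp
qed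

lemma binom_coeff_plus1_tendsto_0:
  assumes "Re s < 0"
  shows "(\<lambda>n. binom_coeff (s + 1) n) \<longlonglongrightarrow> 0"
proof (rule Lim_null_comparison)
  show "eventually (\<lambda>n. norm (binom_coeff (s + 1) n) \<le> exp ((norm s)\<^sup>2) * real (Suc n) powr Re s) sequentially"
    using norm_binom_coeff_plus1_le [of s] assms by auto
  have "(\<lambda>n. real n powr Re s) \<longlonglongrightarrow> 0"
    using assms by (intro tendsto_neg_powr filterlim_real_sequentially) auto
  from tendsto_mult_right_zero [OF LIMSEQ_Suc [OF this]]
  show "(\<lambda>n. exp ((norm s)\<^sup>2) * real (Suc n) powr Re s) \<longlonglongrightarrow> 0" .
qed

text \<open>Abel summation; the boundary term vanishes because a_N(s + 1) tends to 0 and X is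
  bounded. It serves both for the kernel series and, for each single l, for the Beta series.\<close>

lemma sums_binom_coeff_by_parts:
  assumes s: "Re s < 0" and sum: "(\<lambda>n. binom_coeff s n * X n) sums A"
    and bdd: "\<And>n. norm (X n) \<le> B"
  shows "(\<lambda>n. binom_coeff (s + 1) n * (X n - X (Suc n))) sums A"
proof -
  \<comment> \<open>The upper limits differ by one since a_N(s + 1) is the sum of a_0(s), ...,
    a_N(s), including the last.\<close>
  have eq: "(\<Sum>n<N. binom_coeff (s + 1) n * (X n - X (Suc n))) =
          (\<Sum>n<Suc N. binom_coeff s n * X n) - binom_coeff (s + 1) N * X N" for N
  proof (induction N)
    case (Suc N)
    show ?case
      unfolding sum.lessThan_Suc [of _ N] Suc
      unfolding sum.lessThan_Suc binom_coeff_plus1_Suc by (simp add: algebra_simps)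
  qed simp
  have "(\<lambda>N. binom_coeff (s + 1) N * X N) \<longlonglongrightarrow> 0"
  proof (rule Lim_null_comparison)
    show "eventually (\<lambda>n. norm (binom_coeff (s + 1) n * X n) \<le> norm (binom_coeff (s + 1) n) * B) sequentially"
      using bdd by (simp add: norm_mult mult_left_mono)
    show "(\<lambda>n. norm (binom_coeff (s + 1) n) * B) \<longlonglongrightarrow> 0"
      using binom_coeff_plus1_tendsto_0 [OF s]
      by (intro tendsto_mult_left_zero tendsto_norm_zero)
  qed
  hence "(\<lambda>N. (\<Sum>n<Suc N. binom_coeff s n * X n) - binom_coeff (s + 1) N * X N) \<longlonglongrightarrow> A - 0"
    using sum unfolding sums_def by (intro tendsto_diff LIMSEQ_Suc)
  thus ?thesis unfolding sums_def eq by simp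
qed

section \<open>Gauss's summation and the Beta series\<close>

text \<open>The general term of Gauss's series 2F1(s, a; c; 1).\<close>

definition hyp_term :: "complex \<Rightarrow> complex \<Rightarrow> complex \<Rightarrow> nat \<Rightarrow> complex" where
  "hyp_term s a c n = binom_coeff s n * pochhammer a n / pochhammer c n"

text \<open>The right-hand side is a difference of consecutive values of n times the n-th term.
  Summed over n it disappears, which leaves a two-term recurrence between the series with parameters
  c and c + 1.\<close>

lemma hyp_term_contiguous:
  assumes c: "\<And>k::nat. c + of_nat k \<noteq> 0"
  shows "c * (c - a - s) * hyp_term s a c n - (c - a) * (c - s) * hyp_term s a (c + 1) n =
         c * (of_nat n * hyp_term s a c n - of_nat (Suc n) * hyp_term s a c (Suc n))"
proof -
  define t where "t = hyp_term s a c n"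
  define m where "m = (of_nat n :: complex)"
  have c0: "c \<noteq> 0" using c [of 0] by simp
  have cm: "c + m \<noteq> 0" using c by (simp add: m_def)
  have "pochhammer c (Suc n) = c * pochhammer (c + 1) n" by (rule pochhammer_rec)
  moreover have "pochhammer c (Suc n) = pochhammer c n * (c + m)"
    by (simp add: pochhammer_Suc m_def)
  ultimately have p: "pochhammer (c + 1) n = pochhammer c n * (c + m) / c"
    using c0 by (simp add: field_simps)
  have 1: "hyp_term s a (c + 1) n = t * c / (c + m)"
    unfolding hyp_term_def t_def p by simp
  have mS: "1 + m \<noteq> 0" unfolding m_def using of_nat_neq_0[of n] by simp
  have 2: "of_nat (Suc n) * hyp_term s a c (Suc n) = t * (a + m) * (s + m) / (c + m)"
    unfolding hyp_term_def t_def binom_coeff_Suc pochhammer_Suc 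
    using mS by (simp flip: m_def)
  show ?thesis unfolding 1 2 t_def [symmetric] m_def [symmetric]
    using cm by (simp add: divide_simps) (simp add: algebra_simps)
qed

lemma norm_pochhammer_le:
  fixes a c :: complex
  assumes "\<And>k. k < n \<Longrightarrow> norm (a + of_nat k) \<le> norm (c + of_nat k)"
  shows "norm (pochhammer a n) \<le> norm (pochhammer c n)"
  unfolding pochhammer_prod prod_norm [symmetric] by (rule prod_mono) (use assms in auto)

lemma norm_add_le_of_Re_pos:
  assumes "Re a \<ge> 0" "x \<ge> 0"
  shows "norm a \<le> norm (a + of_real x)"
  using assms by (auto simp: cmod_def intro!: power_mono)

text \<open>Gauss's evaluation of the hypergeometric series at 1 with lower parameter \<open>a + 1 + N\<close>:
  the contiguous relation shifts \<open>N\<close>, and the series tends to 1 as \<open>N\<close> grows.\<close>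
lemma binom_coeff_Beta_sums_pos:
  assumes s: "Re s < 0" and a: "Re a > 0"
  shows "(\<lambda>n. binom_coeff s n / (a + of_nat n)) sums (Gamma (1 - s) * Gamma a / Gamma (a + 1 - s))"
proof -
  \<comment> \<open>For N = 0 the quotient \<open>pochhammer a n / pochhammer (a + 1) n\<close>
    equals a / (a + n), so \<open>U 0\<close> is a times the wanted sum.\<close>
  define c where "c N = a + 1 + of_nat N" for N :: nat
  define t where "t N n = hyp_term s a (c N) n" for N n
  define U where "U N = suminf (t N)" for N
  have cnz: "c N + of_nat k \<noteq> 0" for N k
  proof
    assume "c N + of_nat k = 0"
    hence "Re (c N + of_nat k) = 0" by simp
    with a show False by (simp add: c_def)
  qed
  have pz: "pochhammer (c N) n \<noteq> 0" for N n
    using cnz[of N] by (auto simp: pochhammer_eq_0_iff add_eq_0_iff2)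
  have le: "norm (a + of_nat k) \<le> norm (c N + of_nat k)" for N k
  proof -
    have "c N + of_nat k = a + of_nat k + of_real (1 + real N)" by (simp add: c_def)
    thus ?thesis using norm_add_le_of_Re_pos [of "a + of_nat k" "1 + real N"] a by (simp add: c_def add_ac)
  qed
  have bd: "norm (t N n) \<le> norm (binom_coeff s n)" for N n
    using norm_pochhammer_le [of n a "c N"] le [of _ N] pz [of N n]
    by (simp add: t_def hyp_term_def norm_mult norm_divide divide_simps mult_left_mono)
  note sumb = summable_norm_binom_coeff [OF s]
  have summ: "summable (t N)" for N
    by (rule summable_comparison_test' [OF sumb]) (use bd in auto)
  have rec: "c N * (c N - a - s) * U N = (c N - a) * (c N - s) * U (Suc N)" for N
  proof -
    \<comment> \<open>The bound comes from n a_n(s) = s a_{n-1}(s + 1), which tends to 0.\<close>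
    have "(\<lambda>n. of_nat n * t N n) \<longlonglongrightarrow> 0"
    proof (rule LIMSEQ_imp_Suc, rule Lim_null_comparison)
      have "norm (of_nat (Suc n) * t N (Suc n)) \<le> norm s * norm (binom_coeff (s + 1) n)" for n
      proof -
        have "norm (of_nat (Suc n) * t N (Suc n)) \<le> real (Suc n) * norm (binom_coeff s (Suc n))"
          unfolding norm_mult norm_of_nat by (intro mult_left_mono bd) auto
        also have "\<dots> = norm s * norm (binom_coeff (s + 1) n)"
          unfolding binom_coeff_Suc' norm_mult norm_divide norm_of_nat by simp
        finally show ?thesis .
      qed
      thus "eventually (\<lambda>n. norm (of_nat (Suc n) * t N (Suc n)) \<le> norm s * norm (binom_coeff (s + 1) n)) sequentially"
        by simp
      show "(\<lambda>n. norm s * norm (binom_coeff (s + 1) n)) \<longlonglongrightarrow> 0"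
        by (intro tendsto_mult_right_zero tendsto_norm_zero binom_coeff_plus1_tendsto_0 s)
    qed
    from telescope_sums' [OF this]
    have "(\<lambda>n. of_nat n * t N n - of_nat (Suc n) * t N (Suc n)) sums 0" by simp
    hence "(\<lambda>n. c N * (of_nat n * t N n - of_nat (Suc n) * t N (Suc n))) sums (c N * 0)"
      by (rule sums_mult)
    moreover have "c N * (of_nat n * t N n - of_nat (Suc n) * t N (Suc n)) =
       c N * (c N - a - s) * t N n - (c N - a) * (c N - s) * t (Suc N) n" for n
      using hyp_term_contiguous [of "c N" a s n] cnz [of N] by (simp add: t_def c_def add_ac)
    moreover have "(\<lambda>n. c N * (c N - a - s) * t N n - (c N - a) * (c N - s) * t (Suc N) n) sums
        (c N * (c N - a - s) * U N - (c N - a) * (c N - s) * U (Suc N))"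
      unfolding U_def by (intro sums_diff sums_mult summable_sums summ)
    ultimately show ?thesis using sums_unique2 by fastforce
  qed
  have p1: "(1 - s) + of_nat N \<noteq> 0" for N :: nat
    using s by (auto simp: complex_eq_iff)
  \<comment> \<open>Iterating the recurrence collects its four linear factors into Pochhammer
    symbols; c N - a = 1 + N gives \<open>pochhammer 1 N\<close>.\<close>
  have U0: "U 0 = U N * (pochhammer 1 N * pochhammer (a + 1 - s) N / (pochhammer (a + 1) N * pochhammer (1 - s) N))" for N
  proof (induction N)
    case (Suc N)
    have "U N = U (Suc N) * ((1 + of_nat N) * (a + 1 - s + of_nat N) / ((a + 1 + of_nat N) * (1 - s + of_nat N)))"
    proof -
      have "c N * (1 - s + of_nat N) * U N = (1 + of_nat N) * (a + 1 - s + of_nat N) * U (Suc N)"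
        using rec [of N] by (simp add: c_def algebra_simps)
      thus ?thesis
        using cnz [of N 0] p1 [of N]
        by (simp add: c_def nonzero_eq_divide_eq mult_ac del: mult_eq_0_iff)
    qed
    thus ?case unfolding Suc pochhammer_Suc by (simp add: mult_ac)
  qed simp
  have U1: "U \<longlonglongrightarrow> 1"
  proof -
    \<comment> \<open>The term with n = 0 is 1. Every later one contains a / c N, of norm at most
      norm a / (N + 1), while the remaining Pochhammer quotient has norm at most 1.\<close>
    have bound: "norm (U N - 1) \<le> norm a * (\<Sum>n. norm (binom_coeff s (Suc n))) / real (Suc N)" for N
    proof -
      have summ': "summable (\<lambda>n. norm (binom_coeff s (Suc n)))"
        using sumb summable_Suc_iff [of "\<lambda>n. norm (binom_coeff s n)"] by simp
      have "norm (t N (Suc n)) \<le> norm (binom_coeff s (Suc n)) * (norm a / real (Suc N))" for n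
      proof -
        have "norm (pochhammer (a+1) n) \<le> norm (pochhammer (c N + 1) n)"
          using le [of "Suc k" N for k] by (intro norm_pochhammer_le) (simp add: add_ac)
        moreover have "real (Suc N) \<le> norm (c N)"
          using complex_Re_le_cmod [of "c N"] a by (simp add: c_def)
        moreover have "pochhammer (c N + 1) n \<noteq> 0" using pz[of N "Suc n"] by (auto simp: pochhammer_rec)
        ultimately have "norm a * norm (pochhammer (a + 1) n) / (norm (c N) * norm (pochhammer (c N + 1) n)) 
            \<le> norm a / real (Suc N) * 1"
          unfolding times_divide_times_eq [symmetric]
          by (intro mult_mono divide_left_mono) (auto intro!: mult_pos_pos simp: divide_simps)
        hence "norm (binom_coeff s (Suc n)) * (norm a * norm (pochhammer (a + 1) n) / (norm (c N) * norm (pochhammer (c N + 1) n))) 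
            \<le> norm (binom_coeff s (Suc n)) * (norm a / real (Suc N))"
          by (intro mult_left_mono) auto
        thus ?thesis by (simp add: t_def hyp_term_def pochhammer_rec norm_mult norm_divide)
      qed
      hence "norm (\<Sum>n. t N (Suc n)) \<le> (\<Sum>n. norm (binom_coeff s (Suc n)) * (norm a / real (Suc N)))"
        by (rule norm_suminf_le) (intro summable_mult2 summ')
      also have "\<dots> = norm a * (\<Sum>n. norm (binom_coeff s (Suc n))) / real (Suc N)"
        using suminf_mult2 [OF summ', of "norm a / real (Suc N)"] by (simp add: mult_ac)
      also have "(\<Sum>n. t N (Suc n)) = U N - 1"
        using suminf_split_head [OF summ [of N]] by (simp add: U_def t_def hyp_term_def)
      finally show ?thesis .
    qed
    have "(\<lambda>N. norm a * (\<Sum>n. norm (binom_coeff s (Suc n))) / real (Suc N)) \<longlonglongrightarrow> 0"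
      by (rule LIMSEQ_Suc) (rule lim_const_over_n)
    hence "(\<lambda>N. U N - 1) \<longlonglongrightarrow> 0"
      by (rule Lim_null_comparison [OF always_eventually [OF allI [OF bound]]])
    thus ?thesis by (simp add: LIM_zero_iff)
  qed
  have nz: "Gamma (a + 1 - s) \<noteq> 0" 
    using a s by (subst Gamma_eq_zero_iff) (auto elim!: nonpos_Ints_cases' simp: complex_eq_iff)
  have P: "(\<lambda>N. pochhammer 1 N * pochhammer (a + 1 - s) N / (pochhammer (a + 1) N * pochhammer (1 - s) N))
      \<longlonglongrightarrow> (Gamma (a + 1) * Gamma (1 - s)) / (Gamma 1 * Gamma (a + 1 - s))"
  proof (rule Lim_transform_eventually)
    show "(\<lambda>N. Gamma_series' (a + 1) N * Gamma_series' (1 - s) N / (Gamma_series' 1 N * Gamma_series' (a + 1 - s) N))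
      \<longlonglongrightarrow> (Gamma (a + 1) * Gamma (1 - s)) / (Gamma 1 * Gamma (a + 1 - s))"
      using nz by (intro tendsto_intros Gamma_series'_LIMSEQ) auto
    \<comment> \<open>The powers of N cancel because (a + 1) + (1 - s) = 1 + (a + 1 - s).\<close>
    have *: "Gamma_series' (a + 1) N * Gamma_series' (1 - s) N / (Gamma_series' 1 N * Gamma_series' (a + 1 - s) N) =
       pochhammer 1 N * pochhammer (a + 1 - s) N / (pochhammer (a + 1) N * pochhammer (1 - s) N)" for N
    proof -
      define L where "L = (of_real (ln (of_nat N)) :: complex)"
      have "exp ((a + 1) * L) * exp ((1 - s) * L) = exp (1 * L) * exp ((a + 1 - s) * L)"
        by (simp add: algebra_simps flip: exp_add)
      thus ?thesis unfolding Gamma_series'_def L_def [symmetric]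
        by (simp add: field_simps)
    qed
    show "eventually (\<lambda>N. Gamma_series' (a + 1) N * Gamma_series' (1 - s) N / (Gamma_series' 1 N * Gamma_series' (a + 1 - s) N) =
       pochhammer 1 N * pochhammer (a + 1 - s) N / (pochhammer (a + 1) N * pochhammer (1 - s) N)) sequentially"
      using * by simp
  qed
  have "(\<lambda>N. U 0) \<longlonglongrightarrow> 1 * ((Gamma (a + 1) * Gamma (1 - s)) / (Gamma 1 * Gamma (a + 1 - s)))"
    using tendsto_mult [OF U1 P] unfolding U0 [symmetric] .
  hence U: "U 0 = Gamma (a + 1) * Gamma (1 - s) / Gamma (a + 1 - s)"
    by (simp add: LIMSEQ_const_iff)
  have a0: "a \<noteq> 0" using a by auto
  have an: "a + of_nat n \<noteq> 0" for n :: nat using a by (auto simp: complex_eq_iff)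
  have t0: "t 0 = (\<lambda>n. a * (binom_coeff s n / (a + of_nat n)))"
  proof
    fix n
    have "a * pochhammer (a + 1) n = pochhammer a n * (a + of_nat n)"
      using pochhammer_rec [of a n] pochhammer_Suc [of a n] by simp
    hence "pochhammer a n = a * pochhammer (a + 1) n / (a + of_nat n)"
      using an [of n] by (simp add: nonzero_eq_divide_eq)
    thus "t 0 n = a * (binom_coeff s n / (a + of_nat n))"
      using pz [of 0 n] unfolding t_def hyp_term_def c_def by simp
  qed
  have "(\<lambda>n. a * (binom_coeff s n / (a + of_nat n))) sums U 0"
    using summable_sums [OF summ [of 0]] unfolding U_def unfolding t0 .
  hence "(\<lambda>n. binom_coeff s n / (a + of_nat n)) sums (U 0 / a)"
    by (rule sums_mult_D [OF _ a0])
  moreover have "Gamma (a + 1) = a * Gamma a"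
    using a by (subst Gamma_plus1) (auto elim!: nonpos_Ints_cases')
  ultimately show ?thesis using U a0 by (simp add: mult_ac)
qed

text \<open>The application has a = s + \<delta>l with negative real part. Instead of analytic
  continuation in a, the sum at a is reduced to the sum at a + 1 until the real part is
  positive.\<close>

theorem binom_coeff_Beta_sums:
  assumes s: "Re s < 0" and a: "\<And>n::nat. a + of_nat n \<noteq> 0"
  shows "(\<lambda>n. binom_coeff s n / (a + of_nat n)) sums (Gamma (1 - s) * Gamma a / Gamma (a + 1 - s))"
proof -
  have "(\<lambda>n. binom_coeff s n / (a + of_nat n)) sums (Gamma (1 - s) * Gamma a / Gamma (a + 1 - s))"
    if "\<And>n::nat. a + of_nat n \<noteq> 0" "Re a + real m > 0" for m :: nat and a
    using that
  proof (induction m arbitrary: a)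
    case 0
    thus ?case using binom_coeff_Beta_sums_pos [OF s, of a] by simp
  next
    case (Suc m)
    have a0: "a \<noteq> 0" using Suc.prems(1) [of 0] by simp
    have an: "a + of_nat n \<noteq> 0" for n :: nat by (rule Suc.prems(1))
    have an1: "a + 1 + of_nat n \<noteq> 0" for n :: nat using Suc.prems(1) [of "Suc n"] by (simp add: add_ac)
    have IH: "(\<lambda>n. binom_coeff s n / (a + 1 + of_nat n)) sums (Gamma (1 - s) * Gamma (a + 1) / Gamma (a + 1 + 1 - s))"
      using Suc.prems(2) an1 by (intro Suc.IH) auto
    \<comment> \<open>This null sequence starts at 0, so its differences sum to 0. They combine the
      terms at a and at a + 1, giving a times the sum at a as a + 1 - s times the sum at a +
      1.\<close>
    define w where "w n = of_nat n * binom_coeff s n / (a + of_nat n)" for n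
    have w_Suc: "w (Suc n) = binom_coeff s n * (s + of_nat n) / (a + 1 + of_nat n)" for n
      unfolding w_def binom_coeff_Suc using of_nat_neq_0 [of n, where ?'a = complex]
      by (simp add: add_ac mult_ac)
    have diff: "w (Suc n) - w n = binom_coeff s n * (a / (a + of_nat n)) - (a + 1 - s) * (binom_coeff s n / (a + 1 + of_nat n))" for n
      unfolding w_Suc unfolding w_def using an [of n] an1 [of n] by (simp add: divide_simps) (simp add: algebra_simps)
    have "w \<longlonglongrightarrow> 0"
    proof -
      have "(\<lambda>n. (s + of_nat n) / (a + 1 + of_nat n)) \<longlonglongrightarrow> 1"
      proof -
        have "(\<lambda>n. 1 + (s - (a + 1)) / (a + 1 + of_nat n)) \<longlonglongrightarrow> 1 + 0"
          by (intro tendsto_intros tendsto_divide_0 [OF tendsto_const]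
              tendsto_add_filterlim_at_infinity [OF tendsto_const] tendsto_of_nat)
        moreover have "1 + (s - (a + 1)) / (a + 1 + of_nat n) = (s + of_nat n) / (a + 1 + of_nat n)" for n
          using an1 [of n] by (simp add: field_simps)
        ultimately show ?thesis by simp
      qed
      moreover have "binom_coeff s \<longlonglongrightarrow> 0"
        using summable_LIMSEQ_zero [OF summable_norm_cancel [OF summable_norm_binom_coeff [OF s]]] .
      ultimately have "(\<lambda>n. w (Suc n)) \<longlonglongrightarrow> 0 * 1"
        unfolding w_Suc times_divide_eq_right [symmetric] by (intro tendsto_mult)
      thus ?thesis using LIMSEQ_imp_Suc [of w 0] by simp
    qed
    from telescope_sums [OF this]
    have "(\<lambda>n. w (Suc n) - w n) sums 0" by (simp add: w_def)
    from sums_add [OF this sums_mult [OF IH, of "a + 1 - s"]]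
    have "(\<lambda>n. a * (binom_coeff s n / (a + of_nat n))) sums
            ((a + 1 - s) * (Gamma (1 - s) * Gamma (a + 1) / Gamma (a + 1 + 1 - s)))"
      unfolding diff by (simp add: mult_ac)
    hence sums: "(\<lambda>n. binom_coeff s n / (a + of_nat n)) sums
            ((a + 1 - s) * (Gamma (1 - s) * Gamma (a + 1) / Gamma (a + 1 + 1 - s)) / a)"
      by (rule sums_mult_D [OF _ a0])
    have G: "Gamma (a + 1) = a * Gamma a"
    proof (rule Gamma_plus1)
      show "a \<notin> \<int>\<^sub>\<le>\<^sub>0"
        using an by (metis add.left_inverse nonpos_Ints_cases')
    qed
    \<comment> \<open>The point a + 1 - s may be a pole of Gamma. The entire function
      \<open>rGamma\<close> satisfies its recurrence there as well, and dividing by the default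
      value 0 of \<open>Gamma\<close> agrees with its zero.\<close>
    have "(a + 1 - s) * (Gamma (1 - s) * (a * Gamma a) / Gamma (a + 1 + 1 - s)) / a =
            Gamma (1 - s) * Gamma a * ((a + 1 - s) * rGamma (a + 1 - s + 1))"
    proof -
      have "a + 1 + 1 - s = a + 1 - s + 1" by simp
      thus ?thesis unfolding rGamma_inverse_Gamma using a0 by (simp only:) (simp add: divide_inverse)
    qed
    also have "(a + 1 - s) * rGamma (a + 1 - s + 1) = rGamma (a + 1 - s)"
      by (rule rGamma_plus1)
    finally show ?case using sums unfolding G by (simp add: rGamma_inverse_Gamma field_simps)
  qed
  moreover have "Re a + real (nat \<lceil>1 - Re a\<rceil>) > 0" by linarith
  ultimately show ?thesis using a by blast
qed

section \<open>Fourier expansion of the Bernoulli kernel\<close>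

lemma integral_exp_shift:
  fixes w :: complex and x :: real
  assumes "w \<noteq> 0"
  shows "integral {0..1} (\<lambda>t. exp (w * (of_real t - of_real x))) = 
           exp (- w * of_real x) * (exp w - 1) / w"
proof -
  have "((\<lambda>t. exp (w * (of_real t - of_real x)) / w) has_vector_derivative
          exp (w * (of_real t - of_real x))) (at t within {0..1})" for t :: real
  proof -
    have "((\<lambda>t. exp (w * (t - of_real x)) / w) has_field_derivative
            exp (w * (of_real t - of_real x))) (at (of_real t))"
      using assms by (auto intro!: derivative_eq_intros)
    from has_vector_derivative_real_field [OF this] show ?thesis .
  qed
  hence "((\<lambda>t. exp (w * (of_real t - of_real x))) has_integral
           (exp (w * (of_real 1 - of_real x)) / w - exp (w * (of_real 0 - of_real x)) / w)) {0..1}"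
    by (intro fundamental_theorem_of_calculus) auto
  hence "integral {0..1} (\<lambda>t. exp (w * (of_real t - of_real x))) =
           exp (w * (of_real 1 - of_real x)) / w - exp (w * (of_real 0 - of_real x)) / w"
    by (rule integral_unique)
  also have "exp (w * (of_real 1 - of_real x)) = exp w * exp (- w * of_real x)"
    by (simp add: algebra_simps flip: exp_add)
  finally show ?thesis by (simp add: algebra_simps diff_divide_distrib)
qed

lemma exp_2pi_i_int: "exp (2 * pi * \<i> * of_int l) = 1"
  using exp_integer_2pi [of "of_int l"] by (simp add: mult_ac)

lemma norm_exp_2pi_i_int: "norm (exp (2 * pi * \<i> * of_int l * (of_real t - of_real x))) = 1"
  unfolding norm_exp_eq_Re by simp

lemma sum_int_symmetric_Suc:
  "(\<Sum>l\<in>{-int (Suc L)..int (Suc L)}. f l) =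
     f (int (Suc L)) + f (- int (Suc L)) + (\<Sum>l\<in>{-int L..int L}. f l :: 'a :: comm_monoid_add)"
proof -
  have "{-int (Suc L)..int (Suc L)} = insert (int (Suc L)) (insert (- int (Suc L)) {-int L..int L})"
    by auto
  thus ?thesis by (simp add: add.assoc)
qed

lemma has_vector_derivative_exp_mult:
  fixes g :: "complex \<Rightarrow> complex"
  assumes "(g has_field_derivative g') (at (of_real t))"
  shows "((\<lambda>t. g (of_real t) * exp (w * (of_real t - of_real x))) has_vector_derivative
           (g' * exp (w * (of_real t - of_real x)) + w * (g (of_real t) * exp (w * (of_real t - of_real x))))) (at t within S)"
proof -
  have "((\<lambda>t. g t * exp (w * (t - of_real x))) has_field_derivative
           (g' * exp (w * (of_real t - of_real x)) + w * (g (of_real t) * exp (w * (of_real t - of_real x)))))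
         (at (of_real t))"
    by (rule derivative_eq_intros assms refl)+ (simp add: algebra_simps)
  from has_vector_derivative_real_field [OF this] show ?thesis .
qed

text \<open>One integration by parts gains the factor 1/(2 pi l); the boundary values and the
  integral of the derivative are bounded independently of l, the exponentials being
  unimodular.\<close>

lemma riemann_lebesgue_holomorphic:
  assumes g: "g holomorphic_on V" and V: "open V" "of_real ` {0..1::real} \<subseteq> V"
  obtains C where "\<And>l::int. l \<noteq> 0 \<Longrightarrow>
    norm (integral {0..1} (\<lambda>t. g (of_real t) * exp (2 * pi * \<i> * of_int l * (of_real t - of_real x)))) \<le> C / \<bar>of_int l\<bar>"
proof -
  define e where "e l t = exp (2 * pi * \<i> * of_int l * (of_real t - of_real x))" for l :: int and t :: real
  have norm_e: "norm (e l t) = 1" for l t unfolding e_def by (rule norm_exp_2pi_i_int)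
  have inV: "of_real t \<in> V" if "t \<in> {0..1}" for t :: real using that V by auto
  have dg: "deriv g holomorphic_on V" using g V by (intro holomorphic_deriv)
  have cont_e: "continuous_on {0..1} (e l)" for l
    unfolding e_def by (intro continuous_intros)
  have cont_g: "continuous_on {0..1} (\<lambda>t. g (of_real t))"
    by (rule continuous_on_compose2 [OF holomorphic_on_imp_continuous_on [OF g]]) (use inV in \<open>auto intro!: continuous_intros\<close>)
  have cont_dg: "continuous_on {0..1} (\<lambda>t. deriv g (of_real t))"
    by (rule continuous_on_compose2 [OF holomorphic_on_imp_continuous_on [OF dg]]) (use inV in \<open>auto intro!: continuous_intros\<close>)
  obtain B where B: "\<And>t. t \<in> {0..1} \<Longrightarrow> norm (deriv g (of_real t)) \<le> B"
  proof -
    have "compact ((\<lambda>t. deriv g (of_real t)) ` {0..1})"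
      by (intro compact_continuous_image cont_dg compact_Icc)
    hence "bounded ((\<lambda>t. deriv g (of_real t)) ` {0..1})" by (rule compact_imp_bounded)
    thus ?thesis using that unfolding bounded_iff by fastforce
  qed
  define C where "C = norm (g 1) + norm (g 0) + B"
  have "norm (integral {0..1} (\<lambda>t. g (of_real t) * e l t)) \<le> C / \<bar>of_int l\<bar>" if l: "l \<noteq> 0" for l :: int
  proof -
    define w where "w = 2 * pi * \<i> * of_int l"
    have "((\<lambda>t. deriv g (of_real t) * e l t + w * (g (of_real t) * e l t)) has_integral
            (g (of_real 1) * e l 1 - g (of_real 0) * e l 0)) {0..1}"
      unfolding e_def w_def [symmetric]
      by (intro fundamental_theorem_of_calculus has_vector_derivative_exp_mult
            holomorphic_derivI [OF g V(1) inV]) auto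
    moreover have "(\<lambda>t. deriv g (of_real t) * e l t) integrable_on {0..1}"
      by (intro integrable_continuous_interval continuous_intros cont_dg cont_e)
    moreover have "(\<lambda>t. w * (g (of_real t) * e l t)) integrable_on {0..1}"
      by (intro integrable_continuous_interval continuous_intros cont_g cont_e)
    ultimately have "integral {0..1} (\<lambda>t. deriv g (of_real t) * e l t) + w * integral {0..1} (\<lambda>t. g (of_real t) * e l t)
       = g 1 * e l 1 - g 0 * e l 0"
      by (simp add: integral_add [symmetric] integral_unique flip: integral_mult_right)
    hence "w * integral {0..1} (\<lambda>t. g (of_real t) * e l t) =
         g 1 * e l 1 - g 0 * e l 0 - integral {0..1} (\<lambda>t. deriv g (of_real t) * e l t)"
      by (simp add: algebra_simps)
    also have "norm \<dots> \<le> norm (g 1 * e l 1) + norm (g 0 * e l 0) + norm (integral {0..1} (\<lambda>t. deriv g (of_real t) * e l t))"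
      by (meson add_mono norm_triangle_ineq4 order_refl order_trans)
    also have "norm (integral {0..1} (\<lambda>t. deriv g (of_real t) * e l t)) \<le> B * (1 - 0)"
      by (rule integral_bound) (auto intro!: continuous_intros cont_dg cont_e simp: norm_mult norm_e B)
    finally have le: "norm w * norm (integral {0..1} (\<lambda>t. g (of_real t) * e l t)) \<le> C"
      by (simp add: norm_mult norm_e C_def)
    have "\<bar>of_int l\<bar> * 1 \<le> norm w"
      unfolding w_def norm_mult using pi_gt3 mult_left_mono [of 1 "2 * pi" "\<bar>of_int l\<bar>"] by (simp add: mult_ac)
    hence "\<bar>of_int l\<bar> * norm (integral {0..1} (\<lambda>t. g (of_real t) * e l t)) \<le> 
            norm w * norm (integral {0..1} (\<lambda>t. g (of_real t) * e l t))"
      by (intro mult_right_mono) auto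
    also note le
    finally show ?thesis using l by (simp add: field_simps)
  qed
  thus ?thesis using that unfolding e_def by blast
qed

text \<open>Chernoff's argument: write \<open>f t - f x = g t * (e\<^sub>1 t - 1)\<close> with \<open>g\<close> holomorphic near \<open>[0,1]\<close>, so that the
  symmetric partial sums telescope and only two Fourier coefficients of \<open>g\<close> remain.\<close>
theorem fourier_symmetric_partial_sums:
  fixes x :: real
  assumes f: "f holomorphic_on UNIV" and x: "0 < x" "x < 1"
  shows "(\<lambda>L. \<Sum>l\<in>{-int L..int L}.
            integral {0..1} (\<lambda>t. f (of_real t) * exp (2 * pi * \<i> * of_int l * (of_real t - of_real x))))
          \<longlonglongrightarrow> f (of_real x)"
proof -
  define E where "E w = exp (2 * pi * \<i> * (w - of_real x))" for w
  define e where "e l t = exp (2 * pi * \<i> * of_int l * (of_real t - of_real x))" for l :: int and t :: real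
  \<comment> \<open>Both are difference quotients with the singularity at x removed. Their quotient
    \<open>g\<close> is (f - f x) / (E - 1), continued through x.\<close>
  define \<phi> where "\<phi> w = (if w = of_real x then deriv f (of_real x) else (f w - f (of_real x)) / (w - of_real x))" for w
  define \<psi> where "\<psi> w = (if w = of_real x then deriv E (of_real x) else (E w - E (of_real x)) / (w - of_real x))" for w
  \<comment> \<open>The function E takes the value 1 at x + n for integers n only. This open strip
    meets these points just in x, and it contains [0,1] because x lies strictly between 0 and
    1.\<close>
  define V where "V = {w. x - 1 < Re w} \<inter> {w. Re w < x + 1}"
  have V: "open V" unfolding V_def by (intro open_Int open_halfspace_Re_gt open_halfspace_Re_lt)
  have \<phi>: "\<phi> holomorphic_on UNIV" unfolding \<phi>_def using f by (intro pole_lemma_open) auto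
  have \<psi>: "\<psi> holomorphic_on UNIV" unfolding \<psi>_def
    by (intro pole_lemma_open) (auto simp: E_def [abs_def] intro!: holomorphic_intros)
  have E_x: "E (of_real x) = 1" by (simp add: E_def)
  have \<psi>_nz: "\<psi> w \<noteq> 0" if w: "w \<in> V" for w
  proof (cases "w = of_real x")
    case True
    have "(E has_field_derivative 2 * pi * \<i>) (at (of_real x))"
      unfolding E_def by (auto intro!: derivative_eq_intros)
    thus ?thesis using True by (simp add: \<psi>_def DERIV_imp_deriv)
  next
    case False
    have "E w \<noteq> 1"
    proof
      assume "E w = 1"
      then obtain n :: int where "Re (2 * pi * \<i> * (w - of_real x)) = 0" "Im (2 * pi * \<i> * (w - of_real x)) = of_int (2 * n) * pi"
        unfolding E_def exp_eq_1 by blast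
      hence *: "Im w = 0" "Re w - x = of_int n" by (auto simp: mult_ac)
      have "\<bar>Re w - x\<bar> < 1" using w by (auto simp: V_def)
      hence "n = 0" using * by linarith
      thus False using False * by (auto simp: complex_eq_iff)
    qed
    thus ?thesis using False by (simp add: \<psi>_def E_x)
  qed
  define g where "g w = \<phi> w / \<psi> w" for w
  have g: "g holomorphic_on V" unfolding g_def
    by (intro holomorphic_intros holomorphic_on_subset [OF \<phi>] holomorphic_on_subset [OF \<psi>]) (use \<psi>_nz in auto)
  have fg: "f w - f (of_real x) = g w * (E w - 1)" if "w \<in> V" for w
    using \<psi>_nz [OF that] E_x by (cases "w = of_real x") (auto simp: g_def \<phi>_def \<psi>_def)
  have sub: "of_real ` {0..1} \<subseteq> V" using x by (auto simp: V_def)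
  define G where "G l = integral {0..1} (\<lambda>t. g (of_real t) * e l t)" for l
  have cont_e: "continuous_on {0..1} (e l)" for l
    unfolding e_def by (intro continuous_intros)
  have cont_g: "continuous_on {0..1} (\<lambda>t. g (of_real t))"
    by (rule continuous_on_compose2 [OF holomorphic_on_imp_continuous_on [OF g]]) (use sub in \<open>auto intro!: continuous_intros\<close>)
  have int_e: "integral {0..1} (e l) = (if l = 0 then 1 else 0)" for l
  proof (cases "l = 0")
    case False
    hence "2 * pi * \<i> * of_int l \<noteq> 0" by simp
    from integral_exp_shift [OF this, of x] False show ?thesis
      unfolding e_def [abs_def] exp_2pi_i_int by simp
  qed (simp add: e_def [abs_def])
  \<comment> \<open>Multiplication by E raises the frequency by one, so the coefficient of g (E - 1)
    is a difference of neighbouring coefficients of g; the constant f x is seen by l = 0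
    only.\<close>
  have step: "integral {0..1} (\<lambda>t. f (of_real t) * e l t) =
      G (l + 1) - G l + (if l = 0 then f (of_real x) else 0)" for l
  proof -
    have "integral {0..1} (\<lambda>t. f (of_real t) * e l t) =
          integral {0..1} (\<lambda>t. g (of_real t) * e (l + 1) t - g (of_real t) * e l t + f (of_real x) * e l t)"
    proof (rule integral_cong)
      fix t :: real assume "t \<in> {0..1}"
      hence "of_real t \<in> V" using sub by auto
      from fg [OF this] have "f (of_real t) = g (of_real t) * (E (of_real t) - 1) + f (of_real x)"
        by (simp add: algebra_simps)
      moreover have "E (of_real t) * e l t = e (l + 1) t"
        by (simp add: E_def e_def algebra_simps flip: exp_add)
      ultimately show "f (of_real t) * e l t = g (of_real t) * e (l + 1) t - g (of_real t) * e l t + f (of_real x) * e l t"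
        by (simp add: distrib_right left_diff_distrib mult.assoc)
           (simp add: left_diff_distrib right_diff_distrib mult.assoc)
    qed
    also have "\<dots> = G (l + 1) - G l + f (of_real x) * integral {0..1} (e l)"
    proof -
      have "(\<lambda>t. g (of_real t) * e l t) integrable_on {0..1}" for l
        by (intro integrable_continuous_interval continuous_on_mult cont_e cont_g)
      moreover have "(\<lambda>t. f (of_real x) * e l t) integrable_on {0..1}"
        by (intro integrable_continuous_interval continuous_on_mult cont_e continuous_on_const)
      ultimately show ?thesis
        unfolding G_def by (simp add: integral_add integral_diff integrable_diff)
    qed
    finally show ?thesis unfolding int_e by simp
  qed
  have sum: "(\<Sum>l\<in>{-int L..int L}. integral {0..1} (\<lambda>t. f (of_real t) * e l t)) =
      G (int (Suc L)) - G (- int L) + f (of_real x)" for L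
  proof (induction L)
    case 0
    thus ?case by (simp add: step)
  next
    case (Suc L)
    have eq: "- int (Suc L) + 1 = - int L" "int (Suc L) + 1 = int (Suc (Suc L))" by auto
    show ?case
      unfolding sum_int_symmetric_Suc Suc
      using step [of "int (Suc L)"] step [of "- int (Suc L)"] unfolding eq by simp
  qed
  obtain C where C: "\<And>l. l \<noteq> 0 \<Longrightarrow> norm (G l) \<le> C / \<bar>of_int l\<bar>"
    using riemann_lebesgue_holomorphic [OF g V sub, of x] unfolding G_def e_def by blast
  have lim: "(\<lambda>n. C / real n) \<longlonglongrightarrow> 0" by (rule lim_const_over_n)
  have "(\<lambda>L. G (int (Suc L))) \<longlonglongrightarrow> 0"
  proof (rule Lim_null_comparison [OF always_eventually LIMSEQ_Suc [OF lim]], rule allI)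
    show "norm (G (int (Suc L))) \<le> C / real (Suc L)" for L using C [of "int (Suc L)"] by simp
  qed
  moreover have "(\<lambda>L. G (- int L)) \<longlonglongrightarrow> 0"
  proof (rule Lim_null_comparison [OF _ lim])
    show "eventually (\<lambda>L. norm (G (- int L)) \<le> C / real L) sequentially"
      using eventually_gt_at_top [of 0]
    proof eventually_elim
      case (elim L)
      thus ?case using C [of "- int L"] by simp
    qed
  qed
  ultimately have "(\<lambda>L. G (int (Suc L)) - G (- int L) + f (of_real x)) \<longlonglongrightarrow> 0 - 0 + f (of_real x)"
    by (intro tendsto_intros)
  thus ?thesis unfolding sum [symmetric] by (simp add: e_def)
qed

text \<open>The value at \<open>w = 0\<close> fills in the removable singularity.\<close>
definition bernoulli_kernel :: "real \<Rightarrow> complex \<Rightarrow> complex" where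
  "bernoulli_kernel x w =
     (if w = 0 then 1 / 2 - of_real x else exp (w * of_real x) / (1 - exp w) + 1 / w)"

lemma exp_eq_1_iff_2pi_i_int: "exp w = 1 \<longleftrightarrow> (\<exists>l::int. w + 2 * pi * \<i> * of_int l = 0)"
proof
  assume "exp w = 1"
  then obtain n :: int where n: "Re w = 0" "Im w = of_int (2 * n) * pi"
    by (auto simp: exp_eq_1)
  hence "w + 2 * pi * \<i> * of_int (- n) = 0" by (simp add: complex_eq_iff)
  thus "\<exists>l::int. w + 2 * pi * \<i> * of_int l = 0" by blast
next
  assume "\<exists>l::int. w + 2 * pi * \<i> * of_int l = 0"
  then obtain l :: int where "w = 2 * pi * \<i> * of_int (- l)" by (auto simp: add_eq_0_iff2)
  thus "exp w = 1" by (simp only: exp_2pi_i_int)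
qed

text \<open>For w \<noteq> 0 this is the Fourier series of exp (w t) on [0,1] divided by exp w - 1,
  with the term 1/w for l = 0 moved to the other side. For w = 0, which occurs when s is a negative
  integer, the function t takes the place of the exponential and its mean 1/2 is the term
  moved.\<close>

lemma bernoulli_kernel_partial_sums:
  fixes x :: real
  assumes x: "0 < x" "x < 1"
    and w: "\<And>l::int. l \<noteq> 0 \<Longrightarrow> w + 2 * pi * \<i> * of_int l \<noteq> 0"
  shows "(\<lambda>L. \<Sum>l\<in>{-int L..int L} - {0}. exp (- (2 * pi * \<i> * of_int l) * of_real x) / (w + 2 * pi * \<i> * of_int l))
           \<longlonglongrightarrow> - bernoulli_kernel x w"
proof (cases "w = 0")
  case False
  define e where "e l = exp (- (2 * pi * \<i> * of_int l) * of_real x)" for l :: int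
  have nz: "w + 2 * pi * \<i> * of_int l \<noteq> 0" for l :: int using w [of l] False by (cases "l = 0") auto
  have ew: "exp w - 1 \<noteq> 0" using nz by (auto simp: exp_eq_1_iff_2pi_i_int)
  have int: "integral {0..1} (\<lambda>t. exp (w * of_real t) * exp (2 * pi * \<i> * of_int l * (of_real t - of_real x))) =
     e l * (exp w - 1) / (w + 2 * pi * \<i> * of_int l)" for l
  proof -
    have "exp (w * of_real t) * exp (2 * pi * \<i> * of_int l * (of_real t - of_real x)) =
          exp (w * of_real x) * exp ((w + 2 * pi * \<i> * of_int l) * (of_real t - of_real x))" for t
      by (simp add: algebra_simps flip: exp_add)
    hence "integral {0..1} (\<lambda>t. exp (w * of_real t) * exp (2 * pi * \<i> * of_int l * (of_real t - of_real x))) = 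
       exp (w * of_real x) * (exp (- (w + 2 * pi * \<i> * of_int l) * of_real x) * (exp (w + 2 * pi * \<i> * of_int l) - 1) / (w + 2 * pi * \<i> * of_int l))"
      by (simp only: integral_mult_right integral_exp_shift [OF nz])
    also have "exp (w + 2 * pi * \<i> * of_int l) = exp w"
      unfolding exp_add exp_2pi_i_int by simp
    also have "exp (- (w + 2 * pi * \<i> * of_int l) * of_real x) = exp (- (w * of_real x)) * e l"
      by (simp add: e_def algebra_simps flip: exp_add)
    finally show ?thesis by (simp add: exp_minus)
  qed
  have "(\<lambda>L. \<Sum>l\<in>{-int L..int L}. e l * (exp w - 1) / (w + 2 * pi * \<i> * of_int l))
          \<longlonglongrightarrow> exp (w * of_real x)"
    using fourier_symmetric_partial_sums [of "\<lambda>t. exp (w * t)", OF _ x] unfolding int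
    by (simp add: holomorphic_intros)
  hence "(\<lambda>L. (\<Sum>l\<in>{-int L..int L}. e l * (exp w - 1) / (w + 2 * pi * \<i> * of_int l)) / (exp w - 1) - 1 / w)
          \<longlonglongrightarrow> exp (w * of_real x) / (exp w - 1) - 1 / w"
    using ew by (intro tendsto_intros) auto
  also have "(\<lambda>L. (\<Sum>l\<in>{-int L..int L}. e l * (exp w - 1) / (w + 2 * pi * \<i> * of_int l)) / (exp w - 1) - 1 / w) =
             (\<lambda>L. \<Sum>l\<in>{-int L..int L} - {0}. e l / (w + 2 * pi * \<i> * of_int l))"
  proof
    fix L
    show "(\<Sum>l\<in>{-int L..int L}. e l * (exp w - 1) / (w + 2 * pi * \<i> * of_int l)) / (exp w - 1) - 1 / w =
             (\<Sum>l\<in>{-int L..int L} - {0}. e l / (w + 2 * pi * \<i> * of_int l))"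
      using ew unfolding sum_divide_distrib
      by (subst sum.remove [of _ 0]) (auto simp: e_def)
  qed
  also have "exp (w * of_real x) / (exp w - 1) - 1 / w = - bernoulli_kernel x w"
  proof -
    have "exp (w * of_real x) / (1 - exp w) = - (exp (w * of_real x) / (exp w - 1))"
      by (metis minus_diff_eq minus_divide_right)
    thus ?thesis using False by (simp add: bernoulli_kernel_def)
  qed
  finally show ?thesis by (simp add: e_def)
next
  case [simp]: True
  define e where "e l = exp (- (2 * pi * \<i> * of_int l) * of_real x)" for l :: int
  have int: "integral {0..1} (\<lambda>t. of_real t * exp (2 * pi * \<i> * of_int l * (of_real t - of_real x))) =
     e l / (2 * pi * \<i> * of_int l)" if l: "l \<noteq> 0" for l
  proof -
    define v where "v = 2 * pi * \<i> * of_int l"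
    have v: "v \<noteq> 0" using l by (simp add: v_def)
    have "((\<lambda>t. exp (v * (of_real t - of_real x)) + v * (of_real t * exp (v * (of_real t - of_real x)))) has_integral
          (of_real 1 * exp (v * (of_real 1 - of_real x)) - of_real 0 * exp (v * (of_real 0 - of_real x)))) {0..1}"
      by (intro fundamental_theorem_of_calculus)
         (use has_vector_derivative_exp_mult [of "\<lambda>z. z" 1] in auto)
    moreover have "(\<lambda>t. exp (v * (of_real t - of_real x))) integrable_on {0..1}"
      "(\<lambda>t. v * (of_real t * exp (v * (of_real t - of_real x)))) integrable_on {0..1}"
      by (intro integrable_continuous_interval continuous_intros)+
    ultimately have "integral {0..1} (\<lambda>t. exp (v * (of_real t - of_real x))) + 
        v * integral {0..1} (\<lambda>t. of_real t * exp (v * (of_real t - of_real x))) = exp (v * (1 - of_real x))"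
      by (simp add: integral_add [symmetric] integral_unique flip: integral_mult_right)
    also have "integral {0..1} (\<lambda>t. exp (v * (of_real t - of_real x))) = 0"
      unfolding integral_exp_shift [OF v] unfolding v_def exp_2pi_i_int by simp
    also have "exp (v * (1 - of_real x)) = exp v * e l"
      unfolding e_def v_def [symmetric] exp_add [symmetric] by (simp add: algebra_simps)
    also have "exp v = 1" unfolding v_def by (rule exp_2pi_i_int)
    finally show ?thesis using v unfolding v_def [symmetric] by (simp add: nonzero_eq_divide_eq mult_ac)
  qed
  have int0: "integral {0..1} (\<lambda>t. of_real t :: complex) = 1 / 2"
  proof -
    have "((\<lambda>t. (of_real t)\<^sup>2 / 2 :: complex) has_vector_derivative of_real t) (at t within {0..1})" for t :: real
    proof -
      have "((\<lambda>t. t\<^sup>2 / 2 :: complex) has_field_derivative of_real t) (at (of_real t))"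
        by (auto intro!: derivative_eq_intros)
      from has_vector_derivative_real_field [OF this] show ?thesis .
    qed
    hence "((\<lambda>t. of_real t :: complex) has_integral ((of_real 1)\<^sup>2 / 2 - (of_real 0)\<^sup>2 / 2)) {0..1}"
      by (intro fundamental_theorem_of_calculus) auto
    thus ?thesis by (simp add: integral_unique)
  qed
  have "(\<lambda>L. (\<Sum>l\<in>{-int L..int L}. integral {0..1} (\<lambda>t. of_real t * exp (2 * pi * \<i> * of_int l * (of_real t - of_real x)))) - 1 / 2)
          \<longlonglongrightarrow> of_real x - 1 / 2"
    by (intro tendsto_intros fourier_symmetric_partial_sums [of "\<lambda>t. t", OF _ x] holomorphic_on_ident)
  also have "(\<lambda>L. (\<Sum>l\<in>{-int L..int L}. integral {0..1} (\<lambda>t. of_real t * exp (2 * pi * \<i> * of_int l * (of_real t - of_real x)))) - 1 / 2) =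
     (\<lambda>L. \<Sum>l\<in>{-int L..int L} - {0}. e l / (w + 2 * pi * \<i> * of_int l))"
  proof
    fix L
    show "(\<Sum>l\<in>{-int L..int L}. integral {0..1} (\<lambda>t. of_real t * exp (2 * pi * \<i> * of_int l * (of_real t - of_real x)))) - 1 / 2 =
         (\<Sum>l\<in>{-int L..int L} - {0}. e l / (w + 2 * pi * \<i> * of_int l))"
    proof (subst sum.remove [of _ 0])
      have "(\<Sum>l\<in>{-int L..int L} - {0}. integral {0..1} (\<lambda>t. of_real t * exp (2 * pi * \<i> * of_int l * (of_real t - of_real x)))) =
            (\<Sum>l\<in>{-int L..int L} - {0}. e l / (w + 2 * pi * \<i> * of_int l))"
        by (intro sum.cong refl) (simp only: int True DiffD2 singletonI add_0, use int in auto)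
      thus "integral {0..1} (\<lambda>t. of_real t * exp (2 * pi * \<i> * of_int 0 * (of_real t - of_real x))) +
        (\<Sum>l\<in>{-int L..int L} - {0}. integral {0..1} (\<lambda>t. of_real t * exp (2 * pi * \<i> * of_int l * (of_real t - of_real x)))) - 1 / 2 =
         (\<Sum>l\<in>{-int L..int L} - {0}. e l / (w + 2 * pi * \<i> * of_int l))"
        by (simp add: int0)
    qed auto
  qed
  finally show ?thesis by (simp add: e_def bernoulli_kernel_def)
qed

section \<open>Absolutely convergent series for kernel differences\<close>

text \<open>Turns nonvanishing into a uniform bound. Where norm v > 2 R, the norm of w is at least
  norm v - R, hence at least norm v / 2; the finitely many other indices contribute a minimum of
  positive quotients. Estimates on a shifted lattice thus reduce to the lattice itself.\<close>

lemma ex_pos_lower_bound: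
  fixes v w :: "'a \<Rightarrow> complex"
  assumes nz: "\<And>i. i \<in> I \<Longrightarrow> w i \<noteq> 0"
    and close: "\<And>i. i \<in> I \<Longrightarrow> norm (v i - w i) \<le> R"
    and fin: "finite {i \<in> I. norm (v i) \<le> 2 * R}"
  obtains c where "c > 0" "\<And>i. i \<in> I \<Longrightarrow> c * norm (v i) \<le> norm (w i)"
proof -
  define F where "F = {i \<in> I. norm (v i) \<le> 2 * R}"
  \<comment> \<open>The added 1 keeps the denominator positive where v i = 0.\<close>
  define r where "r i = norm (w i) / (norm (v i) + 1)" for i
  define c where "c = Min (insert (1 / 2) (r ` F))"
  have finF: "finite (insert (1 / 2) (r ` F))" using fin by (simp add: F_def)
  have c: "c \<le> 1 / 2" "\<And>i. i \<in> F \<Longrightarrow> c \<le> r i"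
    unfolding c_def by (rule Min_le [OF finF], simp)+
  have rpos: "r i > 0" if "i \<in> F" for i
  proof -
    have "norm (v i) + 1 > 0" by (smt (verit) norm_ge_zero)
    thus ?thesis using that nz by (auto simp: r_def F_def)
  qed
  have "c > 0" unfolding c_def using finF rpos by (subst Min_gr_iff) auto
  moreover have "c * norm (v i) \<le> norm (w i)" if i: "i \<in> I" for i
  proof (cases "i \<in> F")
    case True
    have "c * norm (v i) \<le> c * (norm (v i) + 1)" using \<open>c > 0\<close> by simp
    also have "\<dots> \<le> r i * (norm (v i) + 1)" using c(2) [OF True] by (intro mult_right_mono) auto
    also have "\<dots> = norm (w i)" 
    proof -
      have "norm (v i) + 1 \<noteq> 0" by (smt (verit) norm_ge_zero)
      thus ?thesis by (simp add: r_def)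
    qed
    finally show ?thesis .
  next
    case False
    hence "norm (v i) > 2 * R" using i by (auto simp: F_def)
    moreover have "norm (v i) \<le> norm (w i) + R"
      using close [OF i] norm_triangle_sub [of "v i" "w i"] by simp
    moreover have "c * norm (v i) \<le> 1 / 2 * norm (v i)" using c(1) by (intro mult_right_mono) auto
    ultimately show ?thesis by simp
  qed
  ultimately show ?thesis using that by blast
qed

lemma summable_on_int_split:
  fixes f :: "int \<Rightarrow> 'a :: {topological_comm_monoid_add, t2_space}"
  assumes "(\<lambda>n. f (int (Suc n))) summable_on UNIV" "(\<lambda>n. f (- int (Suc n))) summable_on UNIV"
  shows "f summable_on (UNIV - {0})"
proof -
  have "f summable_on (\<lambda>n. int (Suc n)) ` UNIV"
    using assms(1) by (subst summable_on_reindex) (auto simp: inj_on_def o_def)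
  moreover have "f summable_on (\<lambda>n. - int (Suc n)) ` UNIV"
    using assms(2) by (subst summable_on_reindex) (auto simp: inj_on_def o_def)
  ultimately have "f summable_on (\<lambda>n. int (Suc n)) ` UNIV \<union> (\<lambda>n. - int (Suc n)) ` UNIV"
    by (rule summable_on_Un_disjoint) auto
  also have "(\<lambda>n. int (Suc n)) ` UNIV \<union> (\<lambda>n. - int (Suc n)) ` UNIV = UNIV - {0}"
  proof (intro equalityI subsetI)
    fix l :: int assume "l \<in> UNIV - {0}"
    hence "l = int (Suc (nat (l - 1))) \<or> l = - int (Suc (nat (- l - 1)))" by auto
    thus "l \<in> (\<lambda>n. int (Suc n)) ` UNIV \<union> (\<lambda>n. - int (Suc n)) ` UNIV" by blast
  qed auto
  finally show ?thesis .
qed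

lemma summable_on_powr_Suc: "p < -1 \<Longrightarrow> (\<lambda>n. real (Suc n) powr p) summable_on UNIV"
  using summable_powr_Suc [of p] by (intro norm_summable_imp_summable_on) simp

lemma summable_on_powr_int:
  "p < -1 \<Longrightarrow> (\<lambda>l::int. \<bar>real_of_int l\<bar> powr p) summable_on (UNIV - {0})"
  using summable_on_powr_Suc [of p] by (intro summable_on_int_split) (simp_all add: add_ac)

text \<open>The symmetric intervals are cofinal among the finite sets. Hence an unordered sum, once
  known to exist, equals the limit of the symmetric partial sums that the Fourier argument
  supplies.\<close>

lemma filterlim_symmetric_int_finite_subsets:
  "filterlim (\<lambda>L. {-int L..int L} - {0}) (finite_subsets_at_top (UNIV - {0})) sequentially"
  unfolding filterlim_iff eventually_finite_subsets_at_top
proof (intro allI impI, elim exE conjE)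
  fix P :: "int set \<Rightarrow> bool" and X :: "int set"
  assume P: "\<forall>Y. finite Y \<and> X \<subseteq> Y \<and> Y \<subseteq> UNIV - {0} \<longrightarrow> P Y"
  assume X: "finite X" "X \<subseteq> UNIV - {0}"
  define N where "N = nat (Max (insert 0 (abs ` X)))"
  have le: "\<bar>x\<bar> \<le> int N" if "x \<in> X" for x
  proof -
    have "\<bar>x\<bar> \<le> Max (insert 0 (abs ` X))" using X that by (intro Max_ge) auto
    also have "\<dots> \<le> int N" unfolding N_def by linarith
    finally show ?thesis .
  qed
  show "eventually (\<lambda>L. P ({-int L..int L} - {0})) sequentially"
    using eventually_ge_at_top [of N]
  proof eventually_elim
    case (elim L)
    have "x \<in> {-int L..int L}" if "x \<in> X" for x using le [OF that] elim by auto
    hence "X \<subseteq> {-int L..int L} - {0}" using X by blast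
    thus ?case by (intro P [rule_format] conjI) auto
  qed
qed

text \<open>Each inverse is only of order 1/l, but the difference is (v - w) over the product of the
  denominators, hence of order 1/l^2.\<close>

lemma summable_norm_diff_inverse_shift:
  assumes w: "\<And>l::int. l \<noteq> 0 \<Longrightarrow> w + 2 * pi * \<i> * of_int l \<noteq> 0"
      and v: "\<And>l::int. l \<noteq> 0 \<Longrightarrow> v + 2 * pi * \<i> * of_int l \<noteq> 0"
  shows "(\<lambda>l::int. norm (1 / (w + 2 * pi * \<i> * of_int l) - 1 / (v + 2 * pi * \<i> * of_int l))) summable_on (UNIV - {0})"
proof -
  define a where "a l = 2 * pi * \<i> * of_int l" for l :: int
  have norm_a: "norm (a l) = 2 * pi * \<bar>of_int l\<bar>" for l
    by (simp add: a_def norm_mult)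
  have fin: "finite {l \<in> UNIV - {0}. norm (a l) \<le> R}" for R
  proof (rule finite_subset)
    show "{l \<in> UNIV - {0}. norm (a l) \<le> R} \<subseteq> {-\<lceil>R\<rceil>..\<lceil>R\<rceil>}"
    proof
      fix l :: int assume "l \<in> {l \<in> UNIV - {0}. norm (a l) \<le> R}"
      hence "norm (a l) \<le> R" by simp
      moreover have "\<bar>of_int l\<bar> * 1 \<le> \<bar>of_int l\<bar> * (2 * pi)"
        using pi_gt3 by (intro mult_left_mono) auto
      ultimately have "\<bar>of_int l\<bar> \<le> R" by (simp add: norm_a mult_ac)
      thus "l \<in> {-\<lceil>R\<rceil>..\<lceil>R\<rceil>}" by (simp add: abs_le_iff) linarith
    qed
  qed auto
  obtain c where c: "c > 0" "\<And>l. l \<in> UNIV - {0} \<Longrightarrow> c * norm (a l) \<le> norm (w + a l)"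
    by (rule ex_pos_lower_bound [of "UNIV - {0}" "\<lambda>l. w + a l" a "norm w"])
       (use w fin in \<open>auto simp: a_def\<close>)
  obtain d where d: "d > 0" "\<And>l. l \<in> UNIV - {0} \<Longrightarrow> d * norm (a l) \<le> norm (v + a l)"
    by (rule ex_pos_lower_bound [of "UNIV - {0}" "\<lambda>l. v + a l" a "norm v"])
       (use v fin in \<open>auto simp: a_def\<close>)
  have "(\<lambda>l::int. norm (v - w) / (4 * pi\<^sup>2 * c * d) * \<bar>of_int l\<bar> powr (-2)) summable_on (UNIV - {0})"
    by (intro summable_on_cmult_right summable_on_powr_int) simp
  moreover have "norm (1 / (w + a l) - 1 / (v + a l)) \<le> norm (v - w) / (4 * pi\<^sup>2 * c * d) * \<bar>of_int l\<bar> powr (-2)"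
    if l: "l \<in> UNIV - {0}" for l
  proof -
    have nz: "w + a l \<noteq> 0" "v + a l \<noteq> 0" using w [of l] v [of l] l by (auto simp: a_def)
    have "1 / (w + a l) - 1 / (v + a l) = (v - w) / ((w + a l) * (v + a l))"
      using nz by (simp add: divide_simps)
    hence "norm (1 / (w + a l) - 1 / (v + a l)) = norm (v - w) / (norm (w + a l) * norm (v + a l))"
      by (simp add: norm_divide norm_mult)
    also have "\<dots> \<le> norm (v - w) / ((c * norm (a l)) * (d * norm (a l)))"
      using l c d nz by (intro divide_left_mono mult_mono mult_pos_pos) (auto simp: norm_a)
    also have "\<dots> = norm (v - w) / (4 * pi\<^sup>2 * c * d) * \<bar>of_int l\<bar> powr (-2)"
    proof -
      have "\<bar>real_of_int l\<bar> powr (-2) = 1 / \<bar>real_of_int l\<bar>\<^sup>2"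
        using l by (simp add: powr_minus_divide)
      thus ?thesis by (simp add: norm_a power2_eq_square)
    qed
    finally show ?thesis .
  qed
  ultimately have "(\<lambda>l. norm (1 / (w + a l) - 1 / (v + a l))) summable_on (UNIV - {0})"
    by (rule summable_on_comparison_test) auto
  thus ?thesis by (simp only: a_def)
qed

lemma continuous_on_bernoulli_kernel: "continuous_on A (\<lambda>x. bernoulli_kernel x w)"
  unfolding bernoulli_kernel_def divide_inverse by (cases "w = 0") (auto intro!: continuous_intros)

text \<open>Inside (0,1) the value comes from symmetric partial sums. The endpoint x = 1 follows by
  continuity: the M-test makes the series continuous on [0,1], and so is the difference of the
  kernels.\<close>

lemma bernoulli_kernel_diff_has_sum:
  fixes x :: real
  assumes x: "0 < x" "x \<le> 1"
    and w: "\<And>l::int. l \<noteq> 0 \<Longrightarrow> w + 2 * pi * \<i> * of_int l \<noteq> 0"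
    and v: "\<And>l::int. l \<noteq> 0 \<Longrightarrow> v + 2 * pi * \<i> * of_int l \<noteq> 0"
  shows "((\<lambda>l::int. exp (- (2 * pi * \<i> * of_int l) * of_real x) *
            (1 / (w + 2 * pi * \<i> * of_int l) - 1 / (v + 2 * pi * \<i> * of_int l)))
          has_sum (bernoulli_kernel x v - bernoulli_kernel x w)) (UNIV - {0})"
proof -
  define D where "D l = 1 / (w + 2 * pi * \<i> * of_int l) - 1 / (v + 2 * pi * \<i> * of_int l)" for l :: int
  define e where "e l y = exp (- (2 * pi * \<i> * of_int l) * of_real y)" for l :: int and y :: real
  define W where "W y = (\<Sum>\<^sub>\<infinity>l\<in>UNIV - {0}. e l y * D l)" for y
  have D: "(\<lambda>l. norm (D l)) summable_on (UNIV - {0})"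
    unfolding D_def by (rule summable_norm_diff_inverse_shift) (use w v in auto)
  have norm_e: "norm (e l y) = 1" for l y unfolding e_def norm_exp_eq_Re by simp
  have summ: "(\<lambda>l. e l y * D l) summable_on (UNIV - {0})" for y
    by (rule abs_summable_summable) (use D in \<open>simp add: norm_mult norm_e\<close>)
  have interior: "W y = bernoulli_kernel y v - bernoulli_kernel y w" if y: "y \<in> {0<..<1}" for y
  proof -
    have "(\<lambda>L. \<Sum>l\<in>{-int L..int L} - {0}. e l y * D l) \<longlonglongrightarrow> W y"
      using has_sum_infsum [OF summ [of y]] unfolding has_sum_def W_def
      by (rule filterlim_compose [OF _ filterlim_symmetric_int_finite_subsets])
    moreover have "(\<lambda>L. (\<Sum>l\<in>{-int L..int L} - {0}. e l y / (w + 2 * pi * \<i> * of_int l)) -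
         (\<Sum>l\<in>{-int L..int L} - {0}. e l y / (v + 2 * pi * \<i> * of_int l))) \<longlonglongrightarrow> 
         - bernoulli_kernel y w - (- bernoulli_kernel y v)"
      unfolding e_def by (intro tendsto_diff bernoulli_kernel_partial_sums w v) (use y in auto)
    hence "(\<lambda>L. \<Sum>l\<in>{-int L..int L} - {0}. e l y * D l) \<longlonglongrightarrow> 
         - bernoulli_kernel y w - (- bernoulli_kernel y v)"
      by (simp add: D_def sum_subtractf right_diff_distrib)
    ultimately have "W y = - bernoulli_kernel y w - (- bernoulli_kernel y v)"
      by (rule LIMSEQ_unique)
    thus ?thesis by simp
  qed
  have "uniform_limit {0..1} (\<lambda>F y. \<Sum>l\<in>F. e l y * D l) W (finite_subsets_at_top (UNIV - {0}))"
    unfolding W_def by (rule Weierstrass_m_test_general [OF _ D]) (simp add: norm_mult norm_e)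
  hence cont: "continuous_on {0..1} W"
    by (rule uniform_limit_theorem [rotated])
       (auto simp: e_def intro!: always_eventually continuous_intros)
  have "continuous_on {0..1} (\<lambda>y. W y - (bernoulli_kernel y v - bernoulli_kernel y w))"
    by (intro continuous_intros cont continuous_on_bernoulli_kernel)
  hence "continuous_on (closure {0<..<1}) (\<lambda>y. W y - (bernoulli_kernel y v - bernoulli_kernel y w))"
    by simp
  hence "W x - (bernoulli_kernel x v - bernoulli_kernel x w) = 0"
  proof (rule continuous_constant_on_closure)
    show "x \<in> closure {0<..<1}" using x by simp
  qed (use interior in auto)
  hence "W x = bernoulli_kernel x v - bernoulli_kernel x w" by simp
  thus ?thesis using has_sum_infsum [OF summ [of x]] unfolding W_def e_def D_def by simp
qed

section \<open>Exchange of summation\<close>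

lemma summable_on_product:
  fixes f :: "'a \<Rightarrow> real" and g :: "'b \<Rightarrow> real"
  assumes f: "f summable_on A" and g: "g summable_on B"
    and nonneg: "\<And>x. x \<in> A \<Longrightarrow> f x \<ge> 0" "\<And>y. y \<in> B \<Longrightarrow> g y \<ge> 0"
  shows "(\<lambda>(x, y). f x * g y) summable_on A \<times> B"
proof (rule summable_on_SigmaI)
  show "((\<lambda>y. case (x, y) of (x, y) \<Rightarrow> f x * g y) has_sum f x * infsum g B) B" for x
    using has_sum_cmult_right [OF has_sum_infsum [OF g], of "f x"] by simp
  show "(\<lambda>x. f x * infsum g B) summable_on A" by (intro summable_on_cmult_left f)
qed (use nonneg in auto)

lemma lattice_norm_ge:
  fixes n :: nat and l :: int and t :: real
  shows "real n \<le> norm (of_nat n + \<i> * of_real t * of_int l)"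
    and "\<bar>t\<bar> * \<bar>of_int l\<bar> \<le> norm (of_nat n + \<i> * of_real t * of_int l)"
  using abs_Re_le_cmod [of "of_nat n + \<i> * of_real t * of_int l"]
    abs_Im_le_cmod [of "of_nat n + \<i> * of_real t * of_int l"] by (simp_all add: abs_mult)

lemma finite_lattice_norm_le:
  fixes t :: real
  assumes "t \<noteq> 0"
  shows "finite {i :: nat \<times> int. norm (of_nat (fst i) + \<i> * of_real t * of_int (snd i)) \<le> R}"
proof (rule finite_subset)
  show "{i :: nat \<times> int. norm (of_nat (fst i) + \<i> * of_real t * of_int (snd i)) \<le> R} \<subseteq>
          {..nat \<lceil>R\<rceil>} \<times> {- \<lceil>R / \<bar>t\<bar>\<rceil>..\<lceil>R / \<bar>t\<bar>\<rceil>}"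
  proof
    fix i :: "nat \<times> int"
    assume i: "i \<in> {i. norm (of_nat (fst i) + \<i> * of_real t * of_int (snd i)) \<le> R}"
    obtain n l where [simp]: "i = (n, l)" by force
    have "norm (of_nat n + \<i> * of_real t * of_int l) \<le> R" using i by simp
    hence "real n \<le> R" "\<bar>t\<bar> * \<bar>of_int l\<bar> \<le> R"
      using lattice_norm_ge [where n = n and t = t and l = l] by linarith+
    hence "real n \<le> R" "\<bar>of_int l\<bar> \<le> R / \<bar>t\<bar>"
      using assms by (simp_all add: field_simps)
    hence "n \<le> nat \<lceil>R\<rceil>" "\<bar>l\<bar> \<le> \<lceil>R / \<bar>t\<bar>\<rceil>" by linarith+
    thus "i \<in> {..nat \<lceil>R\<rceil>} \<times> {- \<lceil>R / \<bar>t\<bar>\<rceil>..\<lceil>R / \<bar>t\<bar>\<rceil>}" by auto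
  qed
qed auto

text \<open>The norm of \<open>n + 1 + \<i> t l\<close> dominates both \<open>n + 1\<close> and \<open>|t l|\<close>, so its square dominates a
  product \<open>(n + 1)\<^bsup>1 - \<kappa>\<^esup> |t l|\<^bsup>1 + \<kappa>\<^esup>\<close>; choosing \<open>\<kappa> < - Re s\<close> makes both factors summable.\<close>
lemma binom_coeff_lattice_summable:
  fixes t :: real
  assumes s: "Re s < 0" and t: "t \<noteq> 0"
    and nz: "\<And>(n::nat) (l::int). l \<noteq> 0 \<Longrightarrow> s + of_nat n + \<i> * of_real t * of_int l \<noteq> 0"
  shows "(\<lambda>(n, l). norm (binom_coeff (s + 1) n / ((s + of_nat n + \<i> * of_real t * of_int l) *
            (s + of_nat (Suc n) + \<i> * of_real t * of_int l)))) summable_on UNIV \<times> (UNIV - {0})"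
proof -
  define v where "v n l = of_nat n + \<i> * of_real t * of_int l" for n :: nat and l :: int
  define w where "w n l = s + of_nat n + \<i> * of_real t * of_int l" for n :: nat and l :: int
  \<comment> \<open>The comparison point is n + 1 + \<i>tl, at distance norm (1 - s), so that the
    real part is \<open>Suc n\<close> and never 0.\<close>
  obtain c where c: "c > 0" "\<And>i. i \<in> UNIV \<times> (UNIV - {0}) \<Longrightarrow> c * norm (v (Suc (fst i)) (snd i)) \<le> norm (w (fst i) (snd i))"
  proof (rule ex_pos_lower_bound [of "UNIV \<times> (UNIV - {0})" "\<lambda>i. w (fst i) (snd i)" "\<lambda>i. v (Suc (fst i)) (snd i)" "norm (1 - s)"])
    show "finite {i \<in> UNIV \<times> (UNIV - {0}). norm (v (Suc (fst i)) (snd i)) \<le> 2 * norm (1 - s)}"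
    proof (rule finite_surj)
      show "finite {i. norm (v (fst i) (snd i)) \<le> 2 * norm (1 - s)}"
        unfolding v_def by (rule finite_lattice_norm_le [OF t])
      show "{i \<in> UNIV \<times> (UNIV - {0}). norm (v (Suc (fst i)) (snd i)) \<le> 2 * norm (1 - s)} \<subseteq>
              (\<lambda>i. (fst i - 1, snd i)) ` {i. norm (v (fst i) (snd i)) \<le> 2 * norm (1 - s)}"
      proof
        fix i assume "i \<in> {i \<in> UNIV \<times> (UNIV - {0}). norm (v (Suc (fst i)) (snd i)) \<le> 2 * norm (1 - s)}"
        thus "i \<in> (\<lambda>i. (fst i - 1, snd i)) ` {i. norm (v (fst i) (snd i)) \<le> 2 * norm (1 - s)}"
          by (intro image_eqI [where x = "(Suc (fst i), snd i)"]) auto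
      qed
    qed
  qed (use nz in \<open>auto simp: v_def w_def\<close>)
  \<comment> \<open>Positivity serves the sum over l, \<kappa> < - Re s the sum over n, and \<kappa>
    \<le> 1 keeps the exponent 1 - \<kappa> nonnegative, as monotonicity of the power
    requires.\<close>
  define \<kappa> where "\<kappa> = min (- Re s) 1 / 2"
  have \<kappa>: "0 < \<kappa>" "\<kappa> \<le> 1" "\<kappa> < - Re s" using s by (auto simp: \<kappa>_def)
  define A where "A = exp ((norm s)\<^sup>2) / (c\<^sup>2 * \<bar>t\<bar> powr (1 + \<kappa>))"
  have "(\<lambda>(n, l). real (Suc n) powr (Re s - (1 - \<kappa>)) * \<bar>real_of_int l\<bar> powr (- (1 + \<kappa>))) summable_on UNIV \<times> (UNIV - {0})"
    using \<kappa> by (intro summable_on_product summable_on_powr_Suc summable_on_powr_int) auto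
  hence summ: "(\<lambda>i. A * (case i of (n, l) \<Rightarrow> real (Suc n) powr (Re s - (1 - \<kappa>)) * \<bar>real_of_int l\<bar> powr (- (1 + \<kappa>)))) summable_on UNIV \<times> (UNIV - {0})"
    by (rule summable_on_cmult_right)
  have le: "norm (binom_coeff (s + 1) n / (w n l * w (Suc n) l)) \<le> 
      A * (real (Suc n) powr (Re s - (1 - \<kappa>)) * \<bar>real_of_int l\<bar> powr (- (1 + \<kappa>)))" if l: "l \<noteq> 0" for n l
  proof -
    define N where "N = norm (v (Suc n) l)"
    have N: "real (Suc n) \<le> N" "\<bar>t\<bar> * \<bar>of_int l\<bar> \<le> N"
      unfolding N_def v_def by (rule lattice_norm_ge)+
    have "N > 0" using N(1) by simp
    have 1: "c * N \<le> norm (w n l)" using c(2) [of "(n, l)"] l by (simp add: N_def)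
    \<comment> \<open>The second denominator belongs to the next lattice point to the right, which
      is farther from 0; the same N bounds it.\<close>
    have "N \<le> norm (v (Suc n) l + of_real 1)"
      unfolding N_def by (rule norm_add_le_of_Re_pos) (simp_all add: v_def)
    also have "v (Suc n) l + of_real 1 = v (Suc (Suc n)) l" by (simp add: v_def)
    finally have "c * N \<le> c * norm (v (Suc (Suc n)) l)" using c(1) by simp
    also have "\<dots> \<le> norm (w (Suc n) l)" using c(2) [of "(Suc n, l)"] l by simp
    finally have 2: "c * N \<le> norm (w (Suc n) l)" .
    have "real (Suc n) powr (1 - \<kappa>) * (\<bar>t\<bar> * \<bar>of_int l\<bar>) powr (1 + \<kappa>) \<le> N powr (1 - \<kappa>) * N powr (1 + \<kappa>)"
      using \<kappa> N by (intro mult_mono powr_mono2) auto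
    also have "\<dots> = N\<^sup>2" using \<open>N > 0\<close> by (simp flip: powr_add powr_numeral)
    finally have 3: "real (Suc n) powr (1 - \<kappa>) * (\<bar>t\<bar> * \<bar>of_int l\<bar>) powr (1 + \<kappa>) \<le> N\<^sup>2" .
    have pos: "real (Suc n) powr (1 - \<kappa>) * (\<bar>t\<bar> * \<bar>of_int l\<bar>) powr (1 + \<kappa>) > 0"
      using t l by simp
    have "norm (binom_coeff (s + 1) n / (w n l * w (Suc n) l)) = norm (binom_coeff (s + 1) n) / (norm (w n l) * norm (w (Suc n) l))"
      by (simp add: norm_divide norm_mult)
    also have "\<dots> \<le> (exp ((norm s)\<^sup>2) * real (Suc n) powr Re s) / ((c * N) * (c * N))"
      using s c(1) \<open>N > 0\<close> by (intro frac_le mult_mono norm_binom_coeff_plus1_le 1 2) auto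
    also have "(c * N) * (c * N) = c\<^sup>2 * N\<^sup>2" by (simp add: power2_eq_square)
    also have "(exp ((norm s)\<^sup>2) * real (Suc n) powr Re s) / (c\<^sup>2 * N\<^sup>2) \<le>
      (exp ((norm s)\<^sup>2) * real (Suc n) powr Re s) / (c\<^sup>2 * (real (Suc n) powr (1 - \<kappa>) * (\<bar>t\<bar> * \<bar>of_int l\<bar>) powr (1 + \<kappa>)))"
      using 3 pos c(1) \<open>N > 0\<close> by (intro divide_left_mono mult_left_mono mult_pos_pos) auto
    also have "\<dots> = A * (real (Suc n) powr (Re s - (1 - \<kappa>)) * \<bar>real_of_int l\<bar> powr (- (1 + \<kappa>)))"
      unfolding powr_diff [of _ "Re s" "1 - \<kappa>"] powr_minus_divide A_def powr_mult by simp
    finally show ?thesis .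
  qed
  have "(\<lambda>i. case i of (n, l) \<Rightarrow> norm (binom_coeff (s + 1) n / (w n l * w (Suc n) l))) summable_on UNIV \<times> (UNIV - {0})"
  proof (rule summable_on_comparison_test [OF summ])
    fix i assume i: "i \<in> (UNIV :: nat set) \<times> (UNIV - {0 :: int})"
    obtain n l where [simp]: "i = (n, l)" by force
    show "(case i of (n, l) \<Rightarrow> norm (binom_coeff (s + 1) n / (w n l * w (Suc n) l))) \<le>
        A * (case i of (n, l) \<Rightarrow> real (Suc n) powr (Re s - (1 - \<kappa>)) * \<bar>real_of_int l\<bar> powr (- (1 + \<kappa>)))"
      using le [of l n] i by simp
  qed auto
  thus ?thesis unfolding w_def .
qed

text \<open>The constant is 2 + 1: the norm of 1 - exp w is at least 1/2, since exp (-1) \<le> 1/2,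
  and the norm of 1/w is at most 1.\<close>

lemma norm_bernoulli_kernel_le:
  assumes w: "Re w \<le> -1" and x: "0 \<le> x"
  shows "norm (bernoulli_kernel x w) \<le> 3"
proof -
  have w0: "w \<noteq> 0" using w by auto
  have "norm (exp w) = exp (Re w)" by simp
  also have "\<dots> \<le> exp (-1)" using w by simp
  also have "\<dots> \<le> 1 / 2" using exp_ge_add_one_self [of 1] by (simp add: exp_minus field_simps)
  finally have "1 / 2 \<le> norm (1 - exp w)" using norm_triangle_ineq2 [of 1 "exp w"] by simp
  moreover have "norm (exp (w * of_real x)) \<le> 1"
    using w x by (simp add: mult_nonpos_nonneg)
  ultimately have "norm (exp (w * of_real x)) / norm (1 - exp w) \<le> 1 / (1 / 2)"
    by (intro frac_le) auto
  moreover have "1 \<le> norm w" using complex_Re_le_cmod [of "- w"] w by simp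
  hence "norm (1 / w) \<le> 1" by (simp add: norm_divide divide_simps)
  moreover have "norm (bernoulli_kernel x w) \<le> norm (exp (w * of_real x) / (1 - exp w)) + norm (1 / w)"
    using w0 by (simp add: bernoulli_kernel_def norm_triangle_ineq)
  ultimately show ?thesis by (simp add: norm_divide)
qed

text \<open>As c < 0, the arguments move left towards minus infinity, so all but finitely many lie
  in the half-plane of the previous bound.\<close>

lemma bernoulli_kernel_seq_bounded:
  assumes "c < 0" "0 \<le> x"
  obtains B where "\<And>n::nat. norm (bernoulli_kernel x ((s + of_nat n) * of_real c)) \<le> B"
proof -
  have "eventually (\<lambda>n. norm (bernoulli_kernel x ((s + of_nat n) * of_real c)) \<le> 3) sequentially"
    using eventually_ge_at_top [of "nat \<lceil>- Re s - 1 / c\<rceil>"]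
  proof eventually_elim
    case (elim n)
    hence "- Re s - 1 / c \<le> real n" by linarith
    hence "(Re s + real n) * c \<le> (- 1 / c) * c" using assms(1) by (intro mult_right_mono_neg) auto
    thus ?case using assms by (intro norm_bernoulli_kernel_le) auto
  qed
  hence "Bseq (\<lambda>n. bernoulli_kernel x ((s + of_nat n) * of_real c))"
    by (rule BfunI)
  thus ?thesis using that by (auto simp: Bseq_def)
qed

theorem bernoulli_kernel_series_fourier:
  fixes c t x :: real
  assumes s: "Re s < 0" and c: "c < 0" and ct: "c * t = 2 * pi" and x: "0 < x" "x \<le> 1"
    and nz: "\<And>(n::nat) (l::int). l \<noteq> 0 \<Longrightarrow> s + of_nat n + \<i> * of_real t * of_int l \<noteq> 0"
    and H: "(\<lambda>n. binom_coeff s n * bernoulli_kernel x ((s + of_nat n) * of_real c)) sums H"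
  shows "((\<lambda>l::int. - 1 / of_real c * exp (- (2 * pi * \<i> * of_int l) * of_real x) *
            (Gamma (1 - s) * Gamma (s + \<i> * of_real t * of_int l) / Gamma (1 + \<i> * of_real t * of_int l)))
          has_sum H) (UNIV - {0})"
proof -
  have t: "t \<noteq> 0" using ct by auto
  have c0: "complex_of_real c \<noteq> 0" using c by simp
  define K where "K n = bernoulli_kernel x ((s + of_nat n) * of_real c)" for n :: nat
  define e where "e l = exp (- (2 * pi * \<i> * of_int l) * of_real x)" for l :: int
  define u where "u n l = s + of_nat n + \<i> * of_real t * of_int l" for n :: nat and l :: int
  \<comment> \<open>The terms after summation by parts: those with n fixed sum to a kernel
    difference, those with l fixed to a Beta value.\<close>
  define F where "F = (\<lambda>(n, l). binom_coeff (s + 1) n * (e l * (1 / (of_real c * u (Suc n) l) - 1 / (of_real c * u n l))))"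
  have u0: "u n l \<noteq> 0" if "l \<noteq> 0" for n l using nz [OF that] by (simp add: u_def)
  have shift: "(s + of_nat n) * of_real c + 2 * pi * \<i> * of_int l = of_real c * u n l" for n l
  proof -
    have "2 * pi * \<i> * of_int l = of_real c * (\<i> * of_real t * of_int l)"
      unfolding ct [symmetric] by simp
    thus ?thesis by (simp add: u_def algebra_simps)
  qed
  have norm_e: "norm (e l) = 1" for l unfolding e_def norm_exp_eq_Re by simp
  have norm_F: "norm (F (n, l)) = norm (binom_coeff (s + 1) n / (u n l * u (Suc n) l)) * (1 / \<bar>c\<bar>)" if l: "l \<noteq> 0" for n l
  proof -
    have "1 / (of_real c * u (Suc n) l) - 1 / (of_real c * u n l) = - (1 / (u n l * u (Suc n) l)) / of_real c * (u (Suc n) l - u n l)"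
      using c0 u0 [OF l] by (simp add: divide_simps)
    also have "u (Suc n) l - u n l = 1" by (simp add: u_def)
    finally show ?thesis
      by (simp add: F_def norm_mult norm_divide norm_e)
  qed
  have "F summable_on UNIV \<times> (UNIV - {0})"
  proof (rule abs_summable_summable)
    have "(\<lambda>i. (case i of (n, l) \<Rightarrow> norm (binom_coeff (s + 1) n / (u n l * u (Suc n) l))) * (1 / \<bar>c\<bar>)) summable_on UNIV \<times> (UNIV - {0})"
      unfolding u_def by (intro summable_on_cmult_left binom_coeff_lattice_summable s t nz)
    thus "(\<lambda>i. norm (F i)) summable_on UNIV \<times> (UNIV - {0})"
    proof (rule summable_on_cong [THEN iffD1, rotated])
      fix i assume i: "i \<in> (UNIV :: nat set) \<times> (UNIV - {0 :: int})"
      obtain n l where [simp]: "i = (n, l)" by force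
      show "(case i of (n, l) \<Rightarrow> norm (binom_coeff (s + 1) n / (u n l * u (Suc n) l))) * (1 / \<bar>c\<bar>) = norm (F i)"
        using norm_F [of l n] i by simp
    qed
  qed
  then obtain S where S: "(F has_sum S) (UNIV \<times> (UNIV - {0}))"
    by (auto simp: summable_on_def)
  have "((\<lambda>n. binom_coeff (s + 1) n * (K n - K (Suc n))) has_sum S) UNIV"
  proof (rule has_sum_SigmaD [OF S])
    fix n :: nat
    have nz': "of_real c * u n l \<noteq> 0" if "l \<noteq> 0" for n l using c0 u0 [OF that] by simp
    have "((\<lambda>l. e l * (1 / (of_real c * u (Suc n) l) - 1 / (of_real c * u n l))) has_sum (K n - K (Suc n))) (UNIV - {0})"
      using bernoulli_kernel_diff_has_sum [OF x, of "(s + of_nat (Suc n)) * of_real c" "(s + of_nat n) * of_real c"] nz'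
      unfolding shift K_def e_def by blast
    thus "((\<lambda>l. F (n, l)) has_sum binom_coeff (s + 1) n * (K n - K (Suc n))) (UNIV - {0})"
      unfolding F_def prod.case by (rule has_sum_cmult_right)
  qed
  hence "(\<lambda>n. binom_coeff (s + 1) n * (K n - K (Suc n))) sums S" by (rule has_sum_imp_sums)
  \<comment> \<open>Summation by parts of the given series identifies the absolutely convergent
    double sum with \<open>H\<close>.\<close>
  moreover obtain B where "\<And>n. norm (K n) \<le> B"
    using bernoulli_kernel_seq_bounded [OF c, of x s] x unfolding K_def by auto
  hence "(\<lambda>n. binom_coeff (s + 1) n * (K n - K (Suc n))) sums H"
    by (intro sums_binom_coeff_by_parts s) (use H in \<open>auto simp: K_def\<close>)
  ultimately have [simp]: "S = H" by (rule sums_unique2)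
  have S': "((\<lambda>(l, n). F (n, l)) has_sum H) ((UNIV - {0}) \<times> UNIV)"
    using S by (subst (asm) has_sum_swap) simp
  show ?thesis
  proof (rule has_sum_SigmaD [OF S'])
    fix l :: int assume "l \<in> UNIV - {0}"
    hence l: "l \<noteq> 0" by simp
    define a where "a = s + \<i> * of_real t * of_int l"
    have ua: "u n l = a + of_nat n" for n by (simp add: u_def a_def)
    have "(\<lambda>n. F (n, l)) summable_on UNIV"
      using summable_on_SigmaD1 [of "\<lambda>l n. F (n, l)" "UNIV - {0}" "\<lambda>_. UNIV" l] S' l
      by (auto simp: summable_on_def)
    then obtain T where T: "((\<lambda>n. F (n, l)) has_sum T) UNIV" by (auto simp: summable_on_def)
    have an: "a + of_nat n \<noteq> 0" for n :: nat using u0 [OF l, of n] by (simp add: ua)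
    obtain B where B: "\<And>n::nat. norm (1 / (a + of_nat n)) \<le> B"
    proof -
      have "(\<lambda>n. 1 / (a + of_nat n)) \<longlonglongrightarrow> 0"
        by (intro tendsto_divide_0 [OF tendsto_const] tendsto_add_filterlim_at_infinity [OF tendsto_const] tendsto_of_nat)
      hence "Bseq (\<lambda>n. 1 / (a + of_nat n))" by (intro convergent_imp_Bseq convergentI)
      thus ?thesis using that by (auto simp: Bseq_def)
    qed
    \<comment> \<open>The same summation by parts, now for a single l, makes the inner sum over n
      the Beta series.\<close>
    have "(\<lambda>n. binom_coeff (s + 1) n * (1 / (a + of_nat n) - 1 / (a + of_nat (Suc n)))) sums (Gamma (1 - s) * Gamma a / Gamma (a + 1 - s))"
      using binom_coeff_Beta_sums [OF s an] B
      by (intro sums_binom_coeff_by_parts s) auto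
    hence "(\<lambda>n. - 1 / of_real c * e l * (binom_coeff (s + 1) n * (1 / (a + of_nat n) - 1 / (a + of_nat (Suc n))))) sums 
              (- 1 / of_real c * e l * (Gamma (1 - s) * Gamma a / Gamma (a + 1 - s)))"
      by (rule sums_mult)
    moreover have "- 1 / of_real c * e l * (binom_coeff (s + 1) n * (1 / (a + of_nat n) - 1 / (a + of_nat (Suc n)))) = F (n, l)" for n
      unfolding F_def prod.case ua using c0 an [of n] an [of "Suc n"] 
      by (simp add: right_diff_distrib diff_divide_distrib mult_ac)
    ultimately have "(\<lambda>n. F (n, l)) sums (- 1 / of_real c * e l * (Gamma (1 - s) * Gamma a / Gamma (a + 1 - s)))"
      by simp
    moreover have "(\<lambda>n. F (n, l)) sums T" using T by (rule has_sum_imp_sums)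
    ultimately have "T = - 1 / of_real c * e l * (Gamma (1 - s) * Gamma a / Gamma (a + 1 - s))"
      by (rule sums_unique2 [THEN sym])
    moreover have "a + 1 - s = 1 + \<i> * of_real t * of_int l" by (simp add: a_def)
    ultimately show "((\<lambda>n. case (l, n) of (l, n) \<Rightarrow> F (n, l)) has_sum
        - 1 / of_real c * exp (- (2 * pi * \<i> * of_int l) * of_real x) *
            (Gamma (1 - s) * Gamma (s + \<i> * of_real t * of_int l) / Gamma (1 + \<i> * of_real t * of_int l))) UNIV"
      using T unfolding a_def e_def by simp
  qed
qed

section \<open>Meromorphic continuation of the series\<close>

lemma binom_coeff_sums:
  assumes "norm y < 1"
  shows "(\<lambda>n. binom_coeff s n * y ^ n) sums ((1 - y) powr (- s))"
proof -
  have "(- s gchoose n) * (- y) ^ n = binom_coeff s n * y ^ n" for n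
  proof -
    have "(- y) ^ n = (-1) ^ n * y ^ n" by (simp flip: power_mult_distrib)
    thus ?thesis by (simp add: gbinomial_pochhammer binom_coeff_def flip: power_mult_distrib)
  qed
  thus ?thesis using gen_binomial_complex [of "- y" "- s"] assms by simp
qed

lemma summable_norm_binom_coeff_power:
  assumes "norm y < 1"
  shows "summable (\<lambda>n. norm (binom_coeff s n * y ^ n))"
proof (rule powser_insidea)
  define r where "r = (norm y + 1) / 2"
  have "norm (complex_of_real r) < 1" "norm y < norm (complex_of_real r)"
    using assms by (auto simp: r_def)
  thus "summable (\<lambda>n. binom_coeff s n * of_real r ^ n)" "norm y < norm (complex_of_real r)"
    using sums_summable [OF binom_coeff_sums] by blast+
qed

text \<open>Compares the factors s + k with R + k. It supplies a majorant common to all s in a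
  disc.\<close>

lemma norm_binom_coeff_mono:
  assumes "norm s \<le> R"
  shows "norm (binom_coeff s n) \<le> norm (binom_coeff (of_real R) n)"
proof -
  have "norm (s + of_nat k) \<le> norm (of_real R + of_nat k :: complex)" for k :: nat
  proof -
    have "norm (s + of_nat k) \<le> R + real k" using norm_triangle_ineq [of s "of_nat k"] assms by simp
    also have "\<dots> \<le> norm (complex_of_real (R + real k))" unfolding norm_of_real by simp
    finally show ?thesis by simp
  qed
  thus ?thesis
    unfolding binom_coeff_def norm_divide by (intro divide_right_mono norm_pochhammer_le) auto
qed

definition zeta_term :: "real \<Rightarrow> real \<Rightarrow> nat \<Rightarrow> complex \<Rightarrow> complex" where
  "zeta_term c x n s = binom_coeff s n * (exp ((s + of_nat n) * of_real (c * x)) / (1 - exp ((s + of_nat n) * of_real c)))"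

text \<open>Where Re (s + n) \<ge> 1 the denominator stays at least 1 - exp c away from 0, and what
  remains is a convergent power series at exp (c x) < 1.\<close>

lemma zeta_term_bound:
  assumes c: "c < 0" and x: "0 < x" and s: "norm s \<le> R" "Re s \<ge> L" "L + real n \<ge> 1"
  shows "norm (zeta_term c x n s) \<le>
           exp (L * (c * x)) / (1 - exp c) * norm (binom_coeff (of_real R) n * of_real (exp (c * x)) ^ n)"
proof -
  have "(Re s + real n) * (c * x) \<le> (L + real n) * (c * x)"
    using c x s by (intro mult_right_mono_neg) (auto simp: mult_nonpos_nonneg)
  hence "norm (exp ((s + of_nat n) * of_real (c * x))) \<le> exp ((L + real n) * (c * x))"
    unfolding norm_exp_eq_Re by simp
  also have "\<dots> = exp (L * (c * x)) * exp (c * x) ^ n"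
    by (simp add: exp_add distrib_right exp_of_nat_mult)
  finally have 1: "norm (exp ((s + of_nat n) * of_real (c * x))) \<le> exp (L * (c * x)) * exp (c * x) ^ n" .
  have "(Re s + real n) * c \<le> 1 * c" using c s by (intro mult_right_mono_neg) auto
  hence "norm (exp ((s + of_nat n) * of_real c)) \<le> exp c" unfolding norm_exp_eq_Re by simp
  hence 2: "1 - exp c \<le> norm (1 - exp ((s + of_nat n) * of_real c))"
    using norm_triangle_ineq2 [of 1 "exp ((s + of_nat n) * of_real c)"] unfolding norm_one by linarith
  have "norm (zeta_term c x n s) \<le> norm (binom_coeff (of_real R) n) * 
      ((exp (L * (c * x)) * exp (c * x) ^ n) / (1 - exp c))"
    unfolding zeta_term_def norm_mult norm_divide
    using c by (intro mult_mono frac_le 1 2 norm_binom_coeff_mono s) auto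
  thus ?thesis by (simp add: norm_mult norm_power mult_ac)
qed

text \<open>On the unit ball around s0 only finitely many terms can have poles: N is chosen so that
  Re (s + n) \<ge> 1 there for all n \<ge> N, and the tail converges uniformly to a holomorphic
  function.\<close>

lemma zeta_term_sum_split:
  assumes c: "c < 0" and x: "0 < x"
  obtains N T where "T analytic_on {s0}" 
    "\<And>s. s \<in> ball s0 1 \<Longrightarrow> summable (\<lambda>n. zeta_term c x n s)"
    "\<And>s. s \<in> ball s0 1 \<Longrightarrow> (\<Sum>n. zeta_term c x n s) = (\<Sum>n<N. zeta_term c x n s) + T s"
proof -
  define L where "L = Re s0 - 1"
  define R where "R = norm s0 + 1"
  define N where "N = nat \<lceil>1 - L\<rceil>"
  have N: "L + real (n + N) \<ge> 1" for n unfolding N_def by linarith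
  have sR: "norm s \<le> R" "Re s \<ge> L" if "s \<in> ball s0 1" for s
  proof -
    have "norm (s - s0) < 1" using that by (simp add: dist_norm norm_minus_commute)
    thus "norm s \<le> R" "Re s \<ge> L"
      using norm_triangle_sub [of s s0] abs_Re_le_cmod [of "s - s0"] by (auto simp: R_def L_def)
  qed
  define M where "M n = exp (L * (c * x)) / (1 - exp c) * norm (binom_coeff (of_real R) n * of_real (exp (c * x)) ^ n)" for n
  have M: "summable M"
    unfolding M_def using c x
    by (intro summable_mult summable_norm_binom_coeff_power) (auto simp: mult_neg_pos)
  hence M': "summable (\<lambda>n. M (n + N))" by (rule summable_ignore_initial_segment)
  have bound: "norm (zeta_term c x (n + N) s) \<le> M (n + N)" if "s \<in> ball s0 1" for s n
    unfolding M_def using sR [OF that] N [of n] by (intro zeta_term_bound c x)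
  define T where "T s = (\<Sum>n. zeta_term c x (n + N) s)" for s
  have hol: "zeta_term c x (n + N) holomorphic_on ball s0 1" for n
  proof -
    have "exp ((s + of_nat (n + N)) * of_real c) \<noteq> 1" if "s \<in> ball s0 1" for s
    proof
      assume "exp ((s + of_nat (n + N)) * of_real c) = 1"
      hence "norm (exp ((s + of_nat (n + N)) * of_real c)) = 1" by simp
      hence "(Re s + real (n + N)) * c = 0" unfolding norm_exp_eq_Re by simp
      thus False using c N [of n] sR [OF that] by auto
    qed
    thus ?thesis unfolding zeta_term_def [abs_def] binom_coeff_def pochhammer_prod
      by (intro holomorphic_intros) auto
  qed
  have "T holomorphic_on ball s0 1"
  proof (rule holomorphic_uniform_sequence)
    show "(\<lambda>s. \<Sum>n<k. zeta_term c x (n + N) s) holomorphic_on ball s0 1" for k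
      by (intro holomorphic_intros hol)
    fix s assume s: "s \<in> ball s0 1"
    then obtain d where d: "d > 0" "cball s d \<subseteq> ball s0 1"
      by (meson open_contains_cball open_ball)
    have "uniform_limit (ball s0 1) (\<lambda>k s. \<Sum>n<k. zeta_term c x (n + N) s) T sequentially"
      unfolding T_def by (rule Weierstrass_m_test [OF bound M'])
    thus "\<exists>d>0. cball s d \<subseteq> ball s0 1 \<and> uniform_limit (cball s d) (\<lambda>k s. \<Sum>n<k. zeta_term c x (n + N) s) T sequentially"
      using d uniform_limit_on_subset by blast
  qed auto
  hence "T analytic_on {s0}"
    using analytic_on_open [of "ball s0 1" T] analytic_on_subset [of T "ball s0 1" "{s0}"] by auto
  moreover have summ: "summable (\<lambda>n. zeta_term c x n s)" if "s \<in> ball s0 1" for s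
  proof -
    have "summable (\<lambda>n. zeta_term c x (n + N) s)"
      by (rule summable_comparison_test' [OF M']) (use bound [OF that] in auto)
    thus ?thesis using summable_iff_shift [of "\<lambda>n. zeta_term c x n s" N] by simp
  qed
  moreover have "(\<Sum>n. zeta_term c x n s) = (\<Sum>n<N. zeta_term c x n s) + T s" if "s \<in> ball s0 1" for s
    using suminf_split_initial_segment [OF summ [OF that], of N] by (simp add: T_def add.commute)
  ultimately show ?thesis by (rule that)
qed

lemma zeta_term_summable:
  assumes "c < 0" "0 < x"
  shows "summable (\<lambda>n. zeta_term c x n s)"
  using zeta_term_sum_split [OF assms, of s] by (metis centre_in_ball zero_less_one)

lemma zeta_term_meromorphic: "zeta_term c x n meromorphic_on A"
proof -
  have "(\<lambda>s. exp ((s + of_nat n) * of_real (c * x)) / (1 - exp ((s + of_nat n) * of_real c))) meromorphic_on A"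
    by (intro meromorphic_on_divide analytic_on_imp_meromorphic_on analytic_intros)
  moreover have "(\<lambda>s. binom_coeff s n) meromorphic_on A"
    unfolding binom_coeff_def pochhammer_prod
    by (intro analytic_on_imp_meromorphic_on analytic_intros) auto
  ultimately show ?thesis unfolding zeta_term_def [abs_def] by (intro meromorphic_on_mult)
qed

lemma zeta_term_analytic:
  assumes "\<And>s. s \<in> A \<Longrightarrow> exp ((s + of_nat n) * of_real c) \<noteq> 1"
  shows "zeta_term c x n analytic_on A"
  unfolding zeta_term_def [abs_def] binom_coeff_def pochhammer_prod using assms
  by (intro analytic_intros) auto

lemma zeta_sum_meromorphic:
  assumes "c < 0" "0 < x"
  shows "(\<lambda>s. \<Sum>n. zeta_term c x n s) meromorphic_on A"
proof (subst meromorphic_on_meromorphic_at, rule ballI)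
  fix s0
  obtain N T where T: "T analytic_on {s0}" 
    "\<And>s. s \<in> ball s0 1 \<Longrightarrow> (\<Sum>n. zeta_term c x n s) = (\<Sum>n<N. zeta_term c x n s) + T s"
    using zeta_term_sum_split [OF assms] by metis
  have "(\<lambda>s. (\<Sum>n<N. zeta_term c x n s) + T s) meromorphic_on {s0}"
    by (intro meromorphic_on_add meromorphic_on_sum zeta_term_meromorphic analytic_on_imp_meromorphic_on T)
  moreover have "eventually (\<lambda>s. (\<Sum>n. zeta_term c x n s) = (\<Sum>n<N. zeta_term c x n s) + T s) (at s0)"
    using eventually_at_in_open' [of "ball s0 1" s0] by (auto elim!: eventually_mono simp: T)
  ultimately show "(\<lambda>s. \<Sum>n. zeta_term c x n s) meromorphic_on {s0}"
    by (subst meromorphic_on_cong) auto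
qed

lemma zeta_sum_analytic_at:
  assumes "c < 0" "0 < x" "\<And>n::nat. exp ((s0 + of_nat n) * of_real c) \<noteq> 1"
  shows "(\<lambda>s. \<Sum>n. zeta_term c x n s) analytic_on {s0}"
proof -
  obtain N T where T: "T analytic_on {s0}" 
    "\<And>s. s \<in> ball s0 1 \<Longrightarrow> (\<Sum>n. zeta_term c x n s) = (\<Sum>n<N. zeta_term c x n s) + T s"
    using zeta_term_sum_split [OF assms(1,2)] by metis
  have "(\<lambda>s. (\<Sum>n<N. zeta_term c x n s) + T s) analytic_on {s0}"
    by (intro analytic_intros zeta_term_analytic T) (use assms in auto)
  moreover have "eventually (\<lambda>s. (\<Sum>n. zeta_term c x n s) = (\<Sum>n<N. zeta_term c x n s) + T s) (nhds s0)"
    using eventually_nhds_in_open [of "ball s0 1" s0] by (auto elim!: eventually_mono simp: T)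
  ultimately show ?thesis by (subst analytic_at_cong) auto
qed

section \<open>Identification with the defining series\<close>

lemma powr_complex_of_real_pos:
  "r > 0 \<Longrightarrow> complex_of_real r powr w = exp (w * of_real (ln r))"
  by (simp add: powr_def Ln_of_real)

definition zeta_prefactor :: "real \<Rightarrow> real \<Rightarrow> complex \<Rightarrow> complex" where
  "zeta_prefactor q z s =
     of_real (q - q\<^sup>2) powr s * of_real q powr (- (of_real z * s))"

text \<open>For Re s > 0 the double series over (k, n) converges absolutely, so the sums over k may
  be taken first. They are geometric and produce the denominators 1 - exp ((s + n) c).\<close>

lemma zeta_q_series_eq:
  assumes q: "0 < q" "q < 1" and z: "0 < z" and s: "Re s > 0"
  shows "zeta_q_series q z s = zeta_prefactor q z s * (\<Sum>n. zeta_term (ln q) z n s)"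
proof -
  define c where "c = ln q"
  have c: "c < 0" using q by (simp add: c_def)
  have pq: "of_real q powr w = exp (w * of_real c)" for w :: complex
    using q unfolding c_def by (intro powr_complex_of_real_pos)
  define F where "F = (\<lambda>(k, n). binom_coeff s n * exp ((s + of_nat n) * of_real (c * (real k + z))))"
  have norm1: "exp (c * (real k + z)) < 1" for k using c z by (auto intro!: mult_neg_pos)
  have summand: "of_real q powr (s * of_nat (k + 1)) / of_real (qnum q (real k + z)) powr s =
      zeta_prefactor q z s * (\<Sum>n. F (k, n))" for k
  proof -
    define y where "y = exp (c * (real k + z))"
    have y: "0 < y" "y < 1" using norm1 by (auto simp: y_def)
    have "qnum q (real k + z) = (1 - y) / (1 - q)"
      using q by (simp add: qnum_def y_def powr_def c_def mult_ac)
    also have "of_real \<dots> powr s = of_real (1 - y) powr s / of_real (1 - q) powr s"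
    proof -
      have "ln ((1 - y) / (1 - q)) = ln (1 - y) - ln (1 - q)" using y q by (simp add: ln_div)
      moreover have "1 - y > 0" "1 - q > 0" "(1 - y) / (1 - q) > 0" using y q by auto
      ultimately show ?thesis
        by (simp only: powr_complex_of_real_pos) (simp add: right_diff_distrib exp_diff)
    qed
    finally have "of_real q powr (s * of_nat (k + 1)) / of_real (qnum q (real k + z)) powr s =
        of_real q powr (s * of_nat (k + 1)) * of_real (1 - q) powr s * of_real (1 - y) powr (- s)"
      by (simp add: powr_minus divide_inverse)
    \<comment> \<open>The origin of the prefactor: q^(s(k+1)) (1 - q)^s = (q - q^2)^s q^(-zs)
      q^(s(k+z)), where the last factor joins the binomial series.\<close>
    also have "of_real q powr (s * of_nat (k + 1)) * of_real (1 - q) powr s =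
        zeta_prefactor q z s * exp (s * of_real (c * (real k + z)))"
    proof -
      have "q - q\<^sup>2 = q * (1 - q)" by (simp add: power2_eq_square algebra_simps)
      hence "ln (q - q\<^sup>2) = c + ln (1 - q)" using q by (simp add: ln_mult c_def)
      moreover have "q - q\<^sup>2 > 0" using \<open>q - q\<^sup>2 = q * (1 - q)\<close> q by simp
      ultimately have "of_real (q - q\<^sup>2) powr s = exp (s * of_real (c + ln (1 - q)))"
        by (simp only: powr_complex_of_real_pos)
      moreover have "of_real (1 - q) powr s = exp (s * of_real (ln (1 - q)))"
        using q by (intro powr_complex_of_real_pos) simp
      ultimately show ?thesis
        unfolding zeta_prefactor_def pq by (simp add: algebra_simps flip: exp_add)
    qed
    also have "of_real (1 - y) powr (- s) = (\<Sum>n. binom_coeff s n * of_real y ^ n)"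
      using binom_coeff_sums [of "of_real y" s] y by (simp add: sums_iff)
    also have "zeta_prefactor q z s * exp (s * of_real (c * (real k + z))) * \<dots> =
        zeta_prefactor q z s * (\<Sum>n. exp (s * of_real (c * (real k + z))) * (binom_coeff s n * of_real y ^ n))"
    proof -
      have "summable (\<lambda>n. binom_coeff s n * of_real y ^ n)"
        using binom_coeff_sums [of "of_real y" s] y by (simp add: sums_iff)
      from suminf_mult [OF this] show ?thesis by simp
    qed
    also have "(\<lambda>n. exp (s * of_real (c * (real k + z))) * (binom_coeff s n * of_real y ^ n)) = (\<lambda>n. F (k, n))"
    proof
      fix n
      have "(of_real y ^ n :: complex) = exp (of_nat n * of_real (c * (real k + z)))"
        unfolding y_def exp_of_nat_mult exp_of_real ..
      thus "exp (s * of_real (c * (real k + z))) * (binom_coeff s n * of_real y ^ n) = F (k, n)"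
        unfolding F_def prod.case distrib_right exp_add by (simp only: mult_ac)
    qed
    finally show ?thesis .
  qed
  have "F summable_on UNIV \<times> UNIV"
  proof (rule abs_summable_summable)
    \<comment> \<open>Expanding (Re s + n) c (k + z) and dropping the nonpositive terms Re s c z and
      n c k leaves a majorant that factors.\<close>
    define f where "f k = exp (Re s * c) ^ k" for k :: nat
    define g where "g n = norm (binom_coeff s n * of_real (exp (c * z)) ^ n)" for n
    have "exp (Re s * c) < 1" using s c by (simp add: mult_pos_neg)
    hence "summable (\<lambda>k. norm (f k))" unfolding f_def by (simp add: norm_power)
    hence f: "f summable_on UNIV" by (rule norm_summable_imp_summable_on)
    have "summable g" unfolding g_def using norm1 [of 0] c z
      by (intro summable_norm_binom_coeff_power) simp
    moreover have "norm (g n) = g n" for n by (simp add: g_def)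
    ultimately have "summable (\<lambda>n. norm (g n))" by simp
    hence g: "g summable_on UNIV" by (rule norm_summable_imp_summable_on)
    have fg: "(\<lambda>(k, n). f k * g n) summable_on UNIV \<times> UNIV"
      by (rule summable_on_product [OF f g]) (auto simp: f_def g_def)
    have le: "norm (F (k, n)) \<le> f k * g n" for k n
    proof -
      have "Re s * (c * z) \<le> 0" "real n * (c * real k) \<le> 0"
        using s c z by (auto simp: mult_le_0_iff)
      hence "(Re s + real n) * (c * (real k + z)) \<le> real k * (Re s * c) + real n * (c * z)"
        by (simp add: algebra_simps)
      hence "norm (exp ((s + of_nat n) * of_real (c * (real k + z)))) \<le> f k * exp (c * z) ^ n"
        unfolding norm_exp_eq_Re f_def exp_of_nat_mult [symmetric] exp_add [symmetric] by simp
      hence "norm (binom_coeff s n) * norm (exp ((s + of_nat n) * of_real (c * (real k + z)))) \<le> norm (binom_coeff s n) * (f k * exp (c * z) ^ n)"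
        by (intro mult_left_mono) auto
      thus ?thesis by (simp add: F_def g_def norm_mult norm_power mult_ac)
    qed
    show "(\<lambda>i. norm (F i)) summable_on UNIV \<times> UNIV"
      by (rule summable_on_comparison_test [OF fg]) (use le in auto)
  qed
  then obtain S where S: "(F has_sum S) (UNIV \<times> UNIV)" by (auto simp: summable_on_def)
  have F1: "(\<lambda>n. F (k, n)) summable_on UNIV" for k
    using summable_on_SigmaD1 [of "\<lambda>k n. F (k, n)" UNIV "\<lambda>_. UNIV" k] S by (auto simp: summable_on_def)
  have F1s: "((\<lambda>n. F (k, n)) has_sum (\<Sum>n. F (k, n))) UNIV" for k
    using has_sum_infsum [OF F1 [of k]] has_sum_imp_sums [OF has_sum_infsum [OF F1 [of k]]]
    by (simp add: sums_iff)
  have "((\<lambda>k. \<Sum>n. F (k, n)) has_sum S) UNIV"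
    by (rule has_sum_SigmaD [OF S]) (rule F1s)
  hence S1: "(\<lambda>k. \<Sum>n. F (k, n)) sums S" by (rule has_sum_imp_sums)
  have S': "((\<lambda>(n, k). F (k, n)) has_sum S) (UNIV \<times> UNIV)"
    using S by (subst (asm) has_sum_swap) simp
  have "((\<lambda>n. zeta_term c z n s) has_sum S) UNIV"
  proof (rule has_sum_SigmaD [OF S'])
    fix n :: nat
    define a where "a = exp ((s + of_nat n) * of_real c)"
    have "(Re s + real n) * c < 0" using s c by (intro mult_pos_neg) auto
    hence a: "norm a < 1" by (simp add: a_def norm_exp_eq_Re)
    have Fa: "F (k, n) = binom_coeff s n * exp ((s + of_nat n) * of_real (c * z)) * a ^ k" for k
    proof -
      have "a ^ k = exp (of_nat k * ((s + of_nat n) * of_real c))"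
        unfolding a_def exp_of_nat_mult ..
      moreover have "(s + of_nat n) * of_real (c * (real k + z)) = (s + of_nat n) * of_real (c * z) + of_nat k * ((s + of_nat n) * of_real c)"
        by (simp add: algebra_simps)
      ultimately show ?thesis by (simp add: F_def exp_add)
    qed
    have "(\<lambda>k. F (k, n)) sums zeta_term c z n s"
      using sums_mult [OF geometric_sums [OF a], of "binom_coeff s n * exp ((s + of_nat n) * of_real (c * z))"]
      unfolding Fa [symmetric] by (simp add: zeta_term_def a_def)
    moreover have "summable (\<lambda>k. norm (F (k, n)))"
      unfolding Fa norm_mult norm_power by (intro summable_mult summable_geometric) (use a in auto)
    ultimately have "((\<lambda>k. F (k, n)) has_sum zeta_term c z n s) UNIV"
      by (intro norm_summable_imp_has_sum)
    thus "((\<lambda>k. case (n, k) of (n, k) \<Rightarrow> F (k, n)) has_sum zeta_term c z n s) UNIV" by simp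
  qed
  hence "(\<lambda>n. zeta_term c z n s) sums S" by (rule has_sum_imp_sums)
  hence "S = (\<Sum>n. zeta_term c z n s)" by (simp add: sums_iff)
  moreover have "(\<lambda>k. zeta_prefactor q z s * (\<Sum>n. F (k, n))) sums (zeta_prefactor q z s * S)"
    by (intro sums_mult S1)
  hence "zeta_q_series q z s = zeta_prefactor q z s * S"
    unfolding zeta_q_series_def summand by (simp add: sums_iff)
  ultimately show ?thesis by (simp add: c_def)
qed

lemma zeta_prefactor_analytic:
  assumes "0 < q" "q < 1"
  shows "zeta_prefactor q z analytic_on A"
proof -
  have "q - q\<^sup>2 > 0" using assms by (simp add: power2_eq_square)
  thus ?thesis
    unfolding zeta_prefactor_def [abs_def] using assms
    by (simp only: powr_complex_of_real_pos) (intro analytic_intros)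
qed

text \<open>\<open>remove_sings Z\<close> witnesses that the choice in \<open>zeta_q\<close> is
  possible, and the identity theorem spreads agreement from Re s > 0 to the plane. The equality
  holds on punctured neighbourhoods, since the values at poles are conventions.\<close>

lemma zeta_q_eventually_eq:
  assumes q: "0 < q" "q < 1" and z: "0 < z"
  shows "eventually (\<lambda>s. zeta_q q z s = zeta_prefactor q z s * (\<Sum>n. zeta_term (ln q) z n s)) (at s0)"
proof -
  define Z where "Z s = zeta_prefactor q z s * (\<Sum>n. zeta_term (ln q) z n s)" for s
  have lnq: "ln q < 0" using q by simp
  have mero: "Z meromorphic_on UNIV"
    unfolding Z_def
    by (intro meromorphic_on_mult zeta_sum_meromorphic lnq z
          analytic_on_imp_meromorphic_on zeta_prefactor_analytic q)
  have analytic: "Z analytic_on {s}" if "Re s > 0" for s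
  proof -
    have "exp ((s + of_nat n) * of_real (ln q)) \<noteq> 1" for n :: nat
    proof
      assume "exp ((s + of_nat n) * of_real (ln q)) = 1"
      hence "norm (exp ((s + of_nat n) * of_real (ln q))) = 1" by simp
      hence "(Re s + real n) * ln q = 0" unfolding norm_exp_eq_Re by simp
      thus False using q that by auto
    qed
    thus ?thesis
      unfolding Z_def by (intro analytic_on_mult zeta_prefactor_analytic zeta_sum_analytic_at lnq z q)
  qed
  have "remove_sings Z nicely_meromorphic_on UNIV \<and> (\<forall>s. 0 < Re s \<longrightarrow> remove_sings Z s = zeta_q_series q z s)"
    using remove_sings_nicely_meromorphic [OF mero] analytic zeta_q_series_eq [OF q z]
    by (simp add: Z_def)
  hence zq: "zeta_q q z nicely_meromorphic_on UNIV \<and> (\<forall>s. 0 < Re s \<longrightarrow> zeta_q q z s = zeta_q_series q z s)"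
    unfolding zeta_q_def
    by (rule someI [where P = "\<lambda>f. f nicely_meromorphic_on UNIV \<and> (\<forall>s. 0 < Re s \<longrightarrow> f s = zeta_q_series q z s)"])
  define g where "g s = zeta_q q z s - Z s" for s
  have "zeta_q q z meromorphic_on UNIV" using zq by (simp add: nicely_meromorphic_on_def)
  hence g: "g meromorphic_on UNIV" unfolding g_def by (intro meromorphic_on_diff mero)
  have g0: "remove_sings g s = 0" if "s \<in> {s. Re s > 0}" for s
  proof (rule remove_sings_eqI, rule tendsto_eventually)
    have "eventually (\<lambda>s. s \<in> {s. Re s > 0}) (at s)"
      using that by (intro eventually_at_in_open' open_halfspace_Re_gt)
    thus "eventually (\<lambda>s. g s = 0) (at s)"
      by eventually_elim (use zq zeta_q_series_eq [OF q z] in \<open>auto simp: g_def Z_def\<close>)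
  qed
  have "remove_sings g constant_on UNIV"
  proof (rule constant_on_extend_nicely_meromorphic_on [OF remove_sings_nicely_meromorphic [OF g]])
    show "remove_sings g constant_on {s. Re s > 0}" using g0 by (auto simp: constant_on_def)
    show "{s. Re s > 0} \<noteq> {}" using complex.sel(1) [of 1 0] by (metis empty_iff mem_Collect_eq zero_less_one)
  qed (auto intro: open_halfspace_Re_gt)
  hence "remove_sings g s = 0" for s
    using g0 [of 1] by (auto simp: constant_on_def)
  moreover have "isolated_singularity_at g s0"
    using g meromorphic_on_subset [of g UNIV "{s0}"] by (intro meromorphic_on_isolated_singularity) auto
  ultimately have "eventually (\<lambda>s. g s = 0) (at s0)"
    using eventually_remove_sings_eq_at [of g s0] by (auto elim!: eventually_mono)
  thus ?thesis by eventually_elim (simp add: g_def Z_def)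
qed

section \<open>Continuity of the kernel series and the value of \<zeta>*\<close>

text \<open>With \<psi>(w) = (exp w - 1) / w the kernel is (\<psi>(w) - exp (w x)) / (w \<psi>(w)),
  so one application of l'Hopital's rule with \<psi>'(0) = 1/2 suffices.\<close>

lemma bernoulli_kernel_tendsto_0: "bernoulli_kernel x \<midarrow>0\<rightarrow> bernoulli_kernel x 0"
proof -
  define \<psi> where "\<psi> w = (if w = 0 then 1 else (exp w - 1) / w)" for w :: complex
  have \<psi>0: "\<psi> 0 = 1" by (simp add: \<psi>_def)
  have "(\<lambda>w. (\<psi> w - \<psi> 0) / (w - 0) - 1 / 2) \<midarrow>0\<rightarrow> 0"
  proof (rule Lim_null_comparison)
    show "eventually (\<lambda>w. norm ((\<psi> w - \<psi> 0) / (w - 0) - 1 / 2) \<le> exp (norm w) * norm w / 2) (at 0)"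
      using eventually_neq_at_within [of 0]
    proof eventually_elim
      case (elim w)
      have "(\<psi> w - \<psi> 0) / (w - 0) - 1 / 2 = (exp w - (\<Sum>i\<le>2. w ^ i / fact i)) / w\<^sup>2"
        using elim by (simp add: \<psi>_def numeral_2_eq_2 field_simps)
      also have "norm \<dots> \<le> (exp (norm w) * norm w ^ Suc 2 / fact 2) / norm (w\<^sup>2)"
        unfolding norm_divide by (intro divide_right_mono Taylor_exp_field) auto
      also have "\<dots> = exp (norm w) * norm w / 2"
        using elim by (simp add: norm_power norm_mult power3_eq_cube power2_eq_square)
      finally show ?case .
    qed
    show "((\<lambda>w::complex. exp (norm w) * norm w / 2) \<longlongrightarrow> 0) (at 0)"
      by (auto intro!: tendsto_eq_intros)
  qed
  hence "(\<lambda>w. (\<psi> w - \<psi> 0) / (w - 0)) \<midarrow>0\<rightarrow> 1 / 2" by (simp only: LIM_zero_iff)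
  hence \<psi>': "(\<psi> has_field_derivative 1 / 2) (at 0)" by (simp add: has_field_derivative_iff)
  have "((\<lambda>w. (\<psi> w - exp (w * of_real x)) / (w * \<psi> w)) \<longlongrightarrow> (1 / 2 - of_real x) / 1) (at 0)"
  proof (rule lhopital_complex_simple)
    show "((\<lambda>w. \<psi> w - exp (w * of_real x)) has_field_derivative 1 / 2 - of_real x) (at 0)"
      using \<psi>' by (auto intro!: derivative_eq_intros)
    show "((\<lambda>w. w * \<psi> w) has_field_derivative 1) (at 0)"
      using DERIV_mult [OF DERIV_ident \<psi>'] \<psi>0 by simp
  qed (auto simp: \<psi>_def)
  moreover have "eventually (\<lambda>w. (\<psi> w - exp (w * of_real x)) / (w * \<psi> w) = bernoulli_kernel x w) (at 0)"
  proof -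
    have "eventually (\<lambda>w::complex. w \<in> ball 0 1 - {0}) (at 0)"
      by (intro eventually_at_in_open) auto
    thus ?thesis
    proof eventually_elim
      case (elim w)
      have "exp w \<noteq> 1"
      proof
        assume "exp w = 1"
        then obtain l :: int where l: "w = - (2 * pi * \<i> * of_int l)"
          unfolding exp_eq_1_iff_2pi_i_int by (auto simp: add_eq_0_iff2)
        have "1 * 1 \<le> 2 * pi * \<bar>real_of_int l\<bar>"
          using l elim pi_gt3 by (intro mult_mono) auto
        moreover have "norm w = 2 * pi * \<bar>real_of_int l\<bar>" unfolding l by (simp add: norm_mult)
        ultimately show False using elim by simp
      qed
      thus ?case using elim by (simp add: \<psi>_def bernoulli_kernel_def divide_simps) (simp add: algebra_simps)
    qed
  qed
  ultimately show ?thesis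
    by (auto simp: bernoulli_kernel_def [of x 0] intro: Lim_transform_eventually)
qed

lemma bernoulli_kernel_isCont:
  assumes w: "\<And>l::int. l \<noteq> 0 \<Longrightarrow> w + 2 * pi * \<i> * of_int l \<noteq> 0"
  shows "isCont (bernoulli_kernel x) w"
proof (cases "w = 0")
  case True
  thus ?thesis using bernoulli_kernel_tendsto_0 by (simp add: isCont_def)
next
  case False
  hence "w + 2 * pi * \<i> * of_int l \<noteq> 0" for l :: int using w [of l] by (cases "l = 0") auto
  hence ew: "exp w \<noteq> 1" by (simp add: exp_eq_1_iff_2pi_i_int)
  have "eventually (\<lambda>v. v \<noteq> 0) (nhds w)" using False by (rule t1_space_nhds)
  hence "eventually (\<lambda>v. bernoulli_kernel x v = exp (v * of_real x) / (1 - exp v) + 1 / v) (nhds w)"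
    by eventually_elim (simp add: bernoulli_kernel_def)
  hence "isCont (bernoulli_kernel x) w \<longleftrightarrow> isCont (\<lambda>v. exp (v * of_real x) / (1 - exp v) + 1 / v) w"
    by (rule isCont_cong)
  moreover have "isCont (\<lambda>v. exp (v * of_real x) / (1 - exp v) + 1 / v) w"
    using ew False by (intro continuous_intros) auto
  ultimately show ?thesis by blast
qed

lemma bernoulli_kernel_series_isCont:
  fixes c :: real
  assumes c: "c < 0" and x: "0 \<le> x" and s0: "Re s0 < 0"
    and nz: "\<And>(n::nat) (l::int). l \<noteq> 0 \<Longrightarrow> (s0 + of_nat n) * of_real c + 2 * pi * \<i> * of_int l \<noteq> 0"
  shows "isCont (\<lambda>s. \<Sum>n. binom_coeff s n * bernoulli_kernel x ((s + of_nat n) * of_real c)) s0"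
proof -
  define f where "f n s = binom_coeff s n * bernoulli_kernel x ((s + of_nat n) * of_real c)" for n s
  \<comment> \<open>The radius keeps Re s \<le> Re s0 / 2 < 0 on the ball, so one exponent serves
    all s; the cap 1 gives norm s \<le> R.\<close>
  define r where "r = min 1 (- Re s0 / 2)"
  have r: "r > 0" "r \<le> 1" "r \<le> - Re s0 / 2" using s0 by (auto simp: r_def)
  define R where "R = norm s0 + 1"
  define M where "M n = R * exp (R\<^sup>2) * 3 * real n powr (Re s0 / 2 - 1)" for n
  have M: "summable M" unfolding M_def using s0
    by (intro summable_mult) (simp add: summable_real_powr_iff)
  have "eventually (\<lambda>n. \<forall>s\<in>ball s0 r. norm (f n s) \<le> M n) sequentially"
    using eventually_ge_at_top [of "nat \<lceil>2 - Re s0 - 1 / c\<rceil>"] eventually_gt_at_top [of 0]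
  proof eventually_elim
    case (elim n)
    show ?case
    proof
      fix s assume "s \<in> ball s0 r"
      hence d: "norm (s - s0) < r" by (simp add: dist_norm norm_minus_commute)
      hence Re: "\<bar>Re s - Re s0\<bar> < r" using abs_Re_le_cmod [of "s - s0"] by simp
      have sR: "norm s \<le> R" using norm_triangle_sub [of s s0] d r by (simp add: R_def)
      have Res: "Re s \<le> Re s0 / 2" using Re r by linarith
      have "- 1 / c \<le> Re s + real n" using elim Re r by linarith
      hence "(Re s + real n) * c \<le> (- 1 / c) * c" using c by (intro mult_right_mono_neg) auto
      hence K: "norm (bernoulli_kernel x ((s + of_nat n) * of_real c)) \<le> 3"
        using c x by (intro norm_bernoulli_kernel_le) auto
      obtain m where m: "n = Suc m" using elim by (cases n) auto
      have "norm (binom_coeff s n) \<le> norm s * exp ((norm s)\<^sup>2) * real n powr (Re s - 1)"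
        unfolding m using Res s0 by (intro norm_binom_coeff_Suc_le) auto
      also have "\<dots> \<le> R * exp (R\<^sup>2) * real n powr (Re s0 / 2 - 1)"
        using sR Res elim by (intro mult_mono powr_mono) (auto simp: R_def intro!: power_mono)
      finally have "norm (f n s) \<le> (R * exp (R\<^sup>2) * real n powr (Re s0 / 2 - 1)) * 3"
        unfolding f_def norm_mult by (intro mult_mono K) (auto simp: R_def)
      thus "norm (f n s) \<le> M n" by (simp add: M_def mult_ac)
    qed
  qed
  hence lim: "uniform_limit (ball s0 r) (\<lambda>N s. \<Sum>n<N. f n s) (\<lambda>s. \<Sum>n. f n s) sequentially"
    by (rule Weierstrass_m_test_ev [OF _ M])
  have cont: "isCont (f n) s0" for n
  proof -
    have "isCont (bernoulli_kernel x) ((s0 + of_nat n) * of_real c)"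
      by (rule bernoulli_kernel_isCont) (rule nz)
    hence "isCont (\<lambda>s. bernoulli_kernel x ((s + of_nat n) * of_real c)) s0"
      by (rule isCont_o2 [rotated]) (intro continuous_intros)
    thus ?thesis unfolding f_def [abs_def] binom_coeff_def pochhammer_prod
      by (intro continuous_intros) auto
  qed
  have "((\<lambda>s. \<Sum>n. f n s) \<longlongrightarrow> (\<Sum>n. f n s0)) (at s0)"
  proof (rule swap_uniform_limit')
    show "\<forall>\<^sub>F N in sequentially. ((\<lambda>s. \<Sum>n<N. f n s) \<longlongrightarrow> (\<Sum>n<N. f n s0)) (at s0)"
      using cont by (intro always_eventually allI tendsto_sum) (simp add: isCont_def)
    show "(\<lambda>N. \<Sum>n<N. f n s0) \<longlonglongrightarrow> (\<Sum>n. f n s0)"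
      using tendsto_uniform_limitI [OF lim, of s0] r by simp
    show "\<forall>\<^sub>F s in at s0. s \<in> ball s0 r"
      using r by (intro eventually_at_in_open') auto
  qed (use lim in auto)
  thus ?thesis by (simp add: isCont_def f_def)
qed

text \<open>By discreteness a punctured neighbourhood avoids the lattice even if s0 is one of its
  points. Including l = 0 keeps s off the nonpositive integers, where pi / sin (pi s) has
  poles.\<close>

lemma eventually_not_in_lattice:
  fixes t :: real
  assumes "t \<noteq> 0"
  shows "eventually (\<lambda>s. \<forall>(n::nat) (l::int). s + of_nat n + \<i> * of_real t * of_int l \<noteq> 0) (at s0)"
proof -
  define p where "p i = - (of_nat (fst i) + \<i> * of_real t * of_int (snd i))" for i :: "nat \<times> int"
  define X where "X = {i. norm (of_nat (fst i) + \<i> * of_real t * of_int (snd i)) \<le> norm s0 + 1}"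
  have "finite (p ` X)" unfolding X_def by (intro finite_imageI finite_lattice_norm_le assms)
  hence "\<not> s0 islimpt (p ` X)" by (rule islimpt_finite)
  hence "eventually (\<lambda>s. s \<notin> p ` X) (at s0)" by (simp add: islimpt_iff_eventually)
  moreover have "eventually (\<lambda>s. s \<in> ball s0 1) (at s0)"
    by (intro eventually_at_in_open') auto
  ultimately show ?thesis
  proof eventually_elim
    case (elim s)
    show ?case
    proof (intro allI notI)
      fix n :: nat and l :: int
      assume "s + of_nat n + \<i> * of_real t * of_int l = 0"
      hence s: "s = p (n, l)"
        unfolding p_def eq_neg_iff_add_eq_0 fst_conv snd_conv by (simp only: add.assoc)
      have "norm s \<le> norm s0 + norm (s - s0)" by (rule norm_triangle_sub)
      also have "\<dots> \<le> norm s0 + 1" using elim by (simp add: dist_norm norm_minus_commute)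
      finally have "(n, l) \<in> X" unfolding s p_def by (simp only: X_def mem_Collect_eq norm_minus_cancel fst_conv snd_conv)
      thus False using s elim by blast
    qed
  qed
qed

text \<open>Near s0 but off the lattice, the terms 1/(c(s + n)) of the reflection formula's series
  merge with the terms of \<zeta> into kernel values. The right-hand side is continuous at s0, so it
  is also the limit that \<open>remove_sings\<close> takes as the value, for negative integers s0
  too.\<close>

lemma zeta_q_star_eq:
  fixes t :: real
  assumes q: "0 < q" "q < 1" and z: "0 < z" and s0: "Re s0 < 0" and t: "ln q * t = 2 * pi"
    and nz: "\<And>(n::nat) (l::int). l \<noteq> 0 \<Longrightarrow> s0 + of_nat n + \<i> * of_real t * of_int l \<noteq> 0"
  shows "zeta_q_star q z s0 = zeta_prefactor q z s0 *
           (\<Sum>n. binom_coeff s0 n * bernoulli_kernel z ((s0 + of_nat n) * of_real (ln q)))"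
proof -
  define c where "c = ln q"
  have c: "c < 0" using q by (simp add: c_def)
  have t0: "t \<noteq> 0" using t by auto
  define H where "H s = (\<Sum>n. binom_coeff s n * bernoulli_kernel z ((s + of_nat n) * of_real c))" for s
  have shift: "(s + of_nat n) * of_real c + 2 * pi * \<i> * of_int l = of_real c * (s + of_nat n + \<i> * of_real t * of_int l)" for s n l
  proof -
    have "2 * pi * \<i> * of_int l = of_real c * (\<i> * of_real t * of_int l)"
      unfolding t [symmetric] c_def by simp
    thus ?thesis by (simp add: algebra_simps)
  qed
  have "eventually (\<lambda>s. zeta_q q z s + zeta_prefactor q z s / of_real c * (of_real pi / sin (of_real pi * s)) =
          zeta_prefactor q z s * H s) (at s0)"
  proof -
    have "eventually (\<lambda>s. s \<in> {s. Re s < 0}) (at s0)"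
      using s0 by (intro eventually_at_in_open' open_halfspace_Re_lt) auto
    with zeta_q_eventually_eq [OF q z] eventually_not_in_lattice [OF t0] show ?thesis
    proof eventually_elim
      case (elim s)
      have s: "Re s < 0" using elim by simp
      have sn: "s + of_nat n \<noteq> 0" for n :: nat
        using elim(2) [rule_format, of n 0] by simp
      have "(\<lambda>n. binom_coeff s n / (s + of_nat n)) sums (Gamma (1 - s) * Gamma s / Gamma (s + 1 - s))"
        by (rule binom_coeff_Beta_sums [OF s sn])
      also have "Gamma (1 - s) * Gamma s / Gamma (s + 1 - s) = of_real pi / sin (of_real pi * s)"
        using Gamma_reflection_complex [of s] by (simp add: mult.commute)
      finally have "(\<lambda>n. 1 / of_real c * (binom_coeff s n / (s + of_nat n))) sums (1 / of_real c * (of_real pi / sin (of_real pi * s)))"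
        by (rule sums_mult)
      from sums_add [OF summable_sums [OF zeta_term_summable [OF c z]] this]
      have "(\<lambda>n. zeta_term c z n s + 1 / of_real c * (binom_coeff s n / (s + of_nat n))) sums
              ((\<Sum>n. zeta_term c z n s) + 1 / of_real c * (of_real pi / sin (of_real pi * s)))" .
      moreover have "zeta_term c z n s + 1 / of_real c * (binom_coeff s n / (s + of_nat n)) =
          binom_coeff s n * bernoulli_kernel z ((s + of_nat n) * of_real c)" for n
      proof -
        define w where "w = (s + of_nat n) * of_real c"
        have "w \<noteq> 0" using sn [of n] c by (simp add: w_def)
        moreover have "(s + of_nat n) * of_real (c * z) = w * of_real z" by (simp add: w_def)
        moreover have "1 / of_real c * (binom_coeff s n / (s + of_nat n)) = binom_coeff s n * (1 / w)"
          by (simp add: w_def)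
        ultimately show ?thesis
          unfolding zeta_term_def bernoulli_kernel_def w_def [symmetric] by (simp only: if_False distrib_left)
      qed
      ultimately have "H s = (\<Sum>n. zeta_term c z n s) + 1 / of_real c * (of_real pi / sin (of_real pi * s))"
        by (simp add: H_def sums_iff)
      thus ?case using elim(1) unfolding c_def by (simp add: distrib_left)
    qed
  qed
  moreover have "isCont H s0"
    unfolding H_def
  proof (rule bernoulli_kernel_series_isCont)
    show "(s0 + of_nat n) * of_real c + 2 * pi * \<i> * of_int l \<noteq> 0" if "l \<noteq> 0" for n :: nat and l :: int
      unfolding shift using nz [OF that] c by simp
  qed (use c z s0 in auto)
  hence "(\<lambda>s. zeta_prefactor q z s * H s) \<midarrow>s0\<rightarrow> zeta_prefactor q z s0 * H s0"
    using analytic_at_imp_isCont [OF zeta_prefactor_analytic [OF q]]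
    by (intro tendsto_mult) (auto simp: isCont_def)
  ultimately have "(\<lambda>s. zeta_q q z s + zeta_prefactor q z s / of_real c * (of_real pi / sin (of_real pi * s)))
      \<midarrow>s0\<rightarrow> zeta_prefactor q z s0 * H s0"
    by (subst tendsto_cong)
  thus ?thesis
    unfolding zeta_q_star_def zeta_prefactor_def c_def H_def by (rule remove_sings_eqI)
qed

theorem theorem3:
  fixes q z :: real and s :: complex
  assumes q: "0 < q" "q < 1"
    and z: "0 < z" "z \<le> 1"
    and s_neg: "Re s < 0"
    and s_avoid: "\<And>(r::nat) (l::int). r > 0 \<Longrightarrow> l \<noteq> 0 \<Longrightarrow>
                    s \<noteq> - of_nat r + (2 * pi * \<i> / ln q) * of_int l"
  shows "((\<lambda>l::int.
            - (1 / (2 * pi * \<i>)) * (complex_of_real (q - q\<^sup>2)) powr s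
              * (complex_of_real q) powr (- (of_real z * s)) * Gamma (1 - s)
              * (1 / of_int l) * (Gamma (s + (2 * pi * \<i> / ln q) * of_int l)
                                  / Gamma ((2 * pi * \<i> / ln q) * of_int l))
              * exp (- 2 * pi * \<i> * of_int l * of_real z))
          has_sum zeta_q_star q z s) (UNIV - {0})"
proof -
  define c where "c = ln q"
  define t where "t = 2 * pi / c"
  have c: "c < 0" using q by (simp add: c_def)
  have ct: "c * t = 2 * pi" using c by (simp add: t_def)
  have t0: "t \<noteq> 0" using ct by auto
  have delta: "2 * pi * \<i> / ln q * of_int l = \<i> * of_real t * of_int l" for l
    by (simp add: t_def c_def)
  have nz: "s + of_nat n + \<i> * of_real t * of_int l \<noteq> 0" if "l \<noteq> 0" for n :: nat and l :: int
  proof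
    assume *: "s + of_nat n + \<i> * of_real t * of_int l = 0"
    \<comment> \<open>The hypothesis speaks of r > 0 only; r = 0 would force Re s = 0.\<close>
    have "n > 0" using arg_cong [OF *, of Re] s_neg by (cases n) auto
    moreover have "s = - (of_nat n + \<i> * of_real t * of_int l)"
      using * by (simp only: eq_neg_iff_add_eq_0 add.assoc)
    hence "s = - of_nat n + \<i> * of_real t * of_int (- l)" by simp
    ultimately show False using s_avoid [of n "- l"] that unfolding delta by simp
  qed
  define K where "K n = bernoulli_kernel z ((s + of_nat n) * of_real c)" for n :: nat
  define H where "H = (\<Sum>n. binom_coeff s n * K n)"
  obtain B where B: "\<And>n. norm (K n) \<le> B"
    using bernoulli_kernel_seq_bounded [OF c, of z s] z unfolding K_def by auto
  have "(\<lambda>n. binom_coeff s n * K n) sums H"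
    unfolding H_def
  proof (rule summable_sums, rule summable_comparison_test')
    show "summable (\<lambda>n. norm (binom_coeff s n) * B)"
      by (intro summable_mult2 summable_norm_binom_coeff s_neg)
    show "norm (binom_coeff s n * K n) \<le> norm (binom_coeff s n) * B" for n
      using B by (simp add: norm_mult mult_left_mono)
  qed
  from bernoulli_kernel_series_fourier [OF s_neg c ct z nz this [unfolded K_def]]
  have "((\<lambda>l::int. zeta_prefactor q z s * (- 1 / of_real c * exp (- (2 * pi * \<i> * of_int l) * of_real z) *
            (Gamma (1 - s) * Gamma (s + \<i> * of_real t * of_int l) / Gamma (1 + \<i> * of_real t * of_int l))))
          has_sum zeta_prefactor q z s * H) (UNIV - {0})"
    by (rule has_sum_cmult_right)
  also have "zeta_prefactor q z s * H = zeta_q_star q z s"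
    using zeta_q_star_eq [OF q z(1) s_neg ct [unfolded c_def] nz] by (simp add: H_def K_def c_def)
  finally show ?thesis
  proof (rule has_sum_cong [THEN iffD1, rotated])
    fix l :: int assume "l \<in> UNIV - {0}"
    hence l: "l \<noteq> 0" by simp
    define d where "d = \<i> * of_real t * of_int l"
    have "Im d \<noteq> 0" using t0 l by (simp add: d_def)
    hence d: "d \<notin> \<int>\<^sub>\<le>\<^sub>0" "d \<noteq> 0" by (auto elim!: nonpos_Ints_cases')
    \<comment> \<open>Together with c d = 2 pi \<i> l this turns 1/(c Gamma (1 + d)) into 1/(2 pi
      \<i> l Gamma d), the form with the factor 1/l.\<close>
    have G: "Gamma (1 + d) = d * Gamma d" using Gamma_plus1 [OF d(1)] by (simp add: add.commute)
    have cd: "of_real c * d = 2 * pi * \<i> * of_int l"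
      unfolding d_def ct [symmetric] by simp
    define e where "e = exp (- (2 * pi * \<i> * of_int l) * of_real z)"
    have e: "exp (- 2 * pi * \<i> * of_int l * of_real z) = e" by (simp add: e_def)
    have "zeta_prefactor q z s * (- 1 / of_real c * e * (Gamma (1 - s) * Gamma (s + d) / Gamma (1 + d))) =
          - (1 / (of_real c * d)) * zeta_prefactor q z s * Gamma (1 - s) * (Gamma (s + d) / Gamma d) * e"
      unfolding G by (simp add: mult_ac)
    thus "zeta_prefactor q z s * (- 1 / of_real c * exp (- (2 * pi * \<i> * of_int l) * of_real z) *
            (Gamma (1 - s) * Gamma (s + \<i> * of_real t * of_int l) / Gamma (1 + \<i> * of_real t * of_int l))) =
          - (1 / (2 * pi * \<i>)) * (complex_of_real (q - q\<^sup>2)) powr s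
              * (complex_of_real q) powr (- (of_real z * s)) * Gamma (1 - s)
              * (1 / of_int l) * (Gamma (s + (2 * pi * \<i> / ln q) * of_int l)
                                  / Gamma ((2 * pi * \<i> / ln q) * of_int l))
              * exp (- 2 * pi * \<i> * of_int l * of_real z)"
      unfolding cd delta e d_def [symmetric] e_def [symmetric] zeta_prefactor_def by simp
  qed
qed

end
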